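(* Let $F>2$, let $W=(H,Q)$ be an $X$-periodic roll wave of the inviscid Saint-Venant equations with speed $c$, let $\Delta(\lambda,\xi)=\lambda\hat\Delta(\lambda,\xi)$ be its periodic Evans-Lopatinsky determinant, and let $\alpha_0=\partial_\lambda\hat\Delta(0,0)$, $\alpha_1=\partial_\xi\hat\Delta(0,0)$. Assume that $\Delta(\cdot,0)$ has a root of multiplicity exactly two at $\lambda=0$, i.e. $\alpha_0\neq0$. Then there are two spectral curves $\lambda_j(\cdot)$, $j=1,2$, analytic in $\xi$ near $\xi=0$, such that, for $(\lambda,\xi)$ near $(0,0)$, $\Delta(\lambda,\xi)=0$ is equivalent to $\lambda=\lambda_j(\xi)$ for some $j\in\{1,2\}$, where $$\lambda_1(\xi)=-i\xi\alpha\big(1-i\xi\gamma+O(\xi^2)\big),\qquad \lambda_2(\xi)\equiv0\quad\text{for }|\xi|\text{ sufficiently small},$$ for some real constants $\alpha,\gamma\in\mathbb{R}$. Moreover, $$\alpha=\frac{\alpha_1}{i\alpha_0}=\frac{\partial_\xi\hat\Delta(0,0)}{i\,\partial_\lambda\hat\Delta(0,0)}=-\frac{X\,\hat\Delta(0,\pi/X)}{2\,\partial_\lambda\hat\Delta(0,0)}.$$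
   Context: Equations. The inviscid Saint-Venant equations are $\partial_t h+\partial_x q=0$, $\partial_t q+\partial_x\big(\tfrac{q^2}{h}+\tfrac{h^2}{2F^2}\big)=h-\tfrac{|q|q}{h^2}$, with Froude number $F$. Roll waves. Fix $F>2$. A roll wave is determined by $H_s>0$ and $H_-$ with $\frac{1+2F+\sqrt{1+4F}}{2F^2}H_s<H_-<H_s$. Put $q_0=H_s^{3/2}/F$, $c=H_s^{1/2}(1+1/F)$, and let $H_+>H_s$ be the unique solution of $\frac{q_0^2}{H_+}+\frac{H_+^2}{2F^2}=\frac{q_0^2}{H_-}+\frac{H_-^2}{2F^2}$. Let $H:[0,X]\to[H_-,H_+]$ be the (increasing) solution of $H'=F^2\,\frac{H^2+(H_s-c^2)H+q_0^2/H_s}{H^2+H_sH+H_s^2}$ with $H(0)=H_-$, where $X>0$ is determined by $H(X)=H_+$, and let $Q=cH-q_0$. The $X$-periodic extension of $(H,Q)|_{(0,X)}$, with shocks at $jX$, $j\in\mathbb{Z}$, is the profile $W$, and $(h,q)(x,t)=(H,Q)(x-ct)$ is the roll wave. Let $x_s\in(0,X)$ be the sonic point, where $H(x_s)=H_s$. Interior eigenvalue equations. For $\lambda\in\mathbb{C}$, consider on $(0,X)$ $$\lambda h+\partial_x(-ch+q)=0,\qquad \lambda q+\partial_x\Big(\big(\tfrac{2Q}{H}-c\big)q+\big(-\tfrac{Q^2}{H^2}+\tfrac{H}{F^2}\big)h\Big)=h-\tfrac{2Q}{H^2}q+\tfrac{2Q^2}{H^3}h.$$ This system is singular at $x_s$.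 For $\Re(\lambda)>-\tfrac{F-2}{2\sqrt{H_s}}$ its space of analytic solutions on the closed cell is one-dimensional; $(h,q)=(h,q)(\cdot;\lambda)$ denotes the analytic solution (depending analytically on $\lambda$) normalized by $$\begin{pmatrix}h\\ q\end{pmatrix}(x_s)=\frac{F-2}{2(F+1)}\sqrt{H_s}\begin{pmatrix}\big(\lambda+\tfrac23\tfrac{F+1}{\sqrt{H_s}}\big)F\\ \lambda\sqrt{H_s}(F-1)+\tfrac23(F+1)^2\end{pmatrix}.$$ Evans-Lopatinsky determinant. For $\Re(\lambda)>-\tfrac{F-2}{2\sqrt{H_s}}$ and $\xi\in[-\pi/X,\pi/X]$, with $\{f\}:=f(X^-)-f(0^+)$ and $\{f\}_\xi:=f(X^-)-e^{i\xi X}f(0^+)$, $$\Delta(\lambda,\xi):=\det\begin{pmatrix}\{\lambda H\}&\{-ch+q\}_\xi\\ \{\lambda Q-(H-\tfrac{Q^2}{H^2})\}&\{(-\tfrac{Q^2}{H^2}+\tfrac{H}{F^2})h+(\tfrac{2Q}{H}-c)q\}_\xi\end{pmatrix}.$$ One has $\Delta(0,\xi)=0$ for all $\xi$, and $\hat\Delta$ denotes the analytic function with $\Delta(\lambda,\xi)=\lambda\hat\Delta(\lambda,\xi)$; as $\lambda\to0$, uniformly in $\xi$, $\hat\Delta(\lambda,\xi)=\alpha_0\lambda+\frac{e^{i\xi X}-1}{iX}\alpha_1+O(|\lambda|(|\lambda|+|\xi|))$ with $\alpha_0=\partial_\lambda\hat\Delta(0,0)$, $\alpha_1=\partial_\xi\hat\Delta(0,0)$.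 *)

theory Defs
  imports "HOL-Complex_Analysis.Complex_Analysis" "HOL-Library.Landau_Symbols"
begin

(* Real analyticity relative to S: at an end point of an interval S the power series
   only has to represent f on the side belonging to S. *)
definition real_analytic_on :: "(real \<Rightarrow> complex) \<Rightarrow> real set \<Rightarrow> bool"
    (infixl \<open>real'_analytic'_on\<close> 50) where
  "f real_analytic_on S \<longleftrightarrow>
     (\<forall>x0\<in>S. \<exists>(a :: nat \<Rightarrow> complex) r. r > 0 \<and>
        (\<forall>x\<in>S. \<bar>x - x0\<bar> < r \<longrightarrow> (\<lambda>n. a n * complex_of_real (x - x0) ^ n) sums f x))"

definition q0 :: "real \<Rightarrow> real \<Rightarrow> real" where
  "q0 F Hs = Hs powr (3/2) / F"

definition wave_speed :: "real \<Rightarrow> real \<Rightarrow> real" where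
  "wave_speed F Hs = sqrt Hs * (1 + 1 / F)"

definition Q :: "real \<Rightarrow> real \<Rightarrow> (real \<Rightarrow> real) \<Rightarrow> real \<Rightarrow> real" where
  "Q F Hs H x = wave_speed F Hs * H x - q0 F Hs"

(* One cell of the profile; its X-periodic extension has shocks at the integer multiples
   of X. The momentum flux is strictly monotone on each side of Hs, so the conditions on Hp
   determine it. *)
definition roll_wave ::
  "real \<Rightarrow> real \<Rightarrow> real \<Rightarrow> real \<Rightarrow> real \<Rightarrow> (real \<Rightarrow> real) \<Rightarrow> bool" where
  "roll_wave F Hs Hm Hp X H \<longleftrightarrow>
     0 < Hs \<and>
     (1 + 2 * F + sqrt (1 + 4 * F)) / (2 * F\<^sup>2) * Hs < Hm \<and> Hm < Hs \<and>
     Hs < Hp \<and>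
     (q0 F Hs)\<^sup>2 / Hp + Hp\<^sup>2 / (2 * F\<^sup>2) = (q0 F Hs)\<^sup>2 / Hm + Hm\<^sup>2 / (2 * F\<^sup>2) \<and>
     0 < X \<and> H ` {0..X} \<subseteq> {Hm..Hp} \<and> strict_mono_on {0..X} H \<and>
     H 0 = Hm \<and> H X = Hp \<and>
     (\<forall>x\<in>{0..X}. (H has_real_derivative
        F\<^sup>2 * ((H x)\<^sup>2 + (Hs - (wave_speed F Hs)\<^sup>2) * H x + (q0 F Hs)\<^sup>2 / Hs)
          / ((H x)\<^sup>2 + Hs * H x + Hs\<^sup>2)) (at x within {0..X}))"

definition spectral_domain :: "real \<Rightarrow> real \<Rightarrow> complex set" where
  "spectral_domain F Hs = {l. Re l > - (F - 2) / (2 * sqrt Hs)}"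

definition mass_flux ::
  "real \<Rightarrow> real \<Rightarrow> (real \<Rightarrow> complex) \<Rightarrow> (real \<Rightarrow> complex) \<Rightarrow> real \<Rightarrow> complex" where
  "mass_flux F Hs h q x = - of_real (wave_speed F Hs) * h x + q x"

definition momentum_flux ::
  "real \<Rightarrow> real \<Rightarrow> (real \<Rightarrow> real) \<Rightarrow> (real \<Rightarrow> complex) \<Rightarrow> (real \<Rightarrow> complex) \<Rightarrow> real \<Rightarrow> complex" where
  "momentum_flux F Hs H h q x =
     of_real (2 * Q F Hs H x / H x - wave_speed F Hs) * q x
     + of_real (- (Q F Hs H x)\<^sup>2 / (H x)\<^sup>2 + H x / F\<^sup>2) * h x"

definition eigenvalue_equations ::
  "real \<Rightarrow> real \<Rightarrow> real \<Rightarrow> (real \<Rightarrow> real) \<Rightarrow> complex \<Rightarrow>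
   (real \<Rightarrow> complex) \<Rightarrow> (real \<Rightarrow> complex) \<Rightarrow> bool" where
  "eigenvalue_equations F Hs X H l h q \<longleftrightarrow>
     (\<forall>x\<in>{0<..<X}.
        (mass_flux F Hs h q has_vector_derivative (- l * h x)) (at x) \<and>
        (momentum_flux F Hs H h q has_vector_derivative
           (h x - of_real (2 * Q F Hs H x / (H x)\<^sup>2) * q x
            + of_real (2 * (Q F Hs H x)\<^sup>2 / (H x)^3) * h x - l * q x)) (at x))"

definition normalized_at ::
  "real \<Rightarrow> real \<Rightarrow> real \<Rightarrow> complex \<Rightarrow> (real \<Rightarrow> complex) \<Rightarrow> (real \<Rightarrow> complex) \<Rightarrow> bool" where
  "normalized_at F Hs xs l h q \<longleftrightarrow>
     h xs = of_real ((F - 2) / (2 * (F + 1)) * sqrt Hs)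
              * ((l + of_real (2/3 * ((F + 1) / sqrt Hs))) * of_real F) \<and>
     q xs = of_real ((F - 2) / (2 * (F + 1)) * sqrt Hs)
              * (l * of_real (sqrt Hs * (F - 1)) + of_real (2/3 * (F + 1)\<^sup>2))"

(* h l x and q l x stand for h(x;l) and q(x;l). *)
definition analytic_solution_family ::
  "real \<Rightarrow> real \<Rightarrow> real \<Rightarrow> (real \<Rightarrow> real) \<Rightarrow> real \<Rightarrow>
   (complex \<Rightarrow> real \<Rightarrow> complex) \<Rightarrow> (complex \<Rightarrow> real \<Rightarrow> complex) \<Rightarrow> bool" where
  "analytic_solution_family F Hs X H xs h q \<longleftrightarrow>
     (\<forall>l\<in>spectral_domain F Hs.
        h l real_analytic_on {0..X} \<and> q l real_analytic_on {0..X} \<and>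
        eigenvalue_equations F Hs X H l (h l) (q l) \<and>
        normalized_at F Hs xs l (h l) (q l)) \<and>
     (\<forall>x\<in>{0..X}. (\<lambda>l. h l x) holomorphic_on spectral_domain F Hs \<and>
                  (\<lambda>l. q l x) holomorphic_on spectral_domain F Hs)"

definition jump :: "real \<Rightarrow> (real \<Rightarrow> complex) \<Rightarrow> complex" where
  "jump X f = Lim (at_left X) f - Lim (at_right 0) f"

definition Bloch_jump :: "real \<Rightarrow> real \<Rightarrow> (real \<Rightarrow> complex) \<Rightarrow> complex" where
  "Bloch_jump X \<xi> f = Lim (at_left X) f - exp (\<i> * of_real (\<xi> * X)) * Lim (at_right 0) f"

definition Evans_Lopatinsky ::
  "real \<Rightarrow> real \<Rightarrow> real \<Rightarrow> (real \<Rightarrow> real) \<Rightarrow>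
   (complex \<Rightarrow> real \<Rightarrow> complex) \<Rightarrow> (complex \<Rightarrow> real \<Rightarrow> complex) \<Rightarrow>
   complex \<Rightarrow> real \<Rightarrow> complex" where
  "Evans_Lopatinsky F Hs X H h q l \<xi> =
     det (vector
       [vector [jump X (\<lambda>x. l * of_real (H x)),
                Bloch_jump X \<xi> (mass_flux F Hs (h l) (q l))],
        vector [jump X (\<lambda>x. l * of_real (Q F Hs H x)
                              - of_real (H x - (Q F Hs H x)\<^sup>2 / (H x)\<^sup>2)),
                Bloch_jump X \<xi> (momentum_flux F Hs H (h l) (q l))]] :: complex^2^2)"

(* zorder is meaningless for a function vanishing identically near z, hence the first clause. *)
definition root_of_multiplicity :: "(complex \<Rightarrow> complex) \<Rightarrow> complex \<Rightarrow> nat \<Rightarrow> bool" where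
  "root_of_multiplicity f z n \<longleftrightarrow>
     (\<exists>\<^sub>F w in at z. f w \<noteq> 0) \<and> f z = 0 \<and> zorder f z = int n"

end

theory Submission
  imports Defs
begin

text \<open>
  Write the determinant as W_X(l) - e W_0(l) with e = exp(i \<xi> X); both W_X and W_0 are holomorphic
  in l. Since it vanishes at l = 0 for \<xi> = 0 and for \<xi> = pi/X, where e = 1 and e = -1, both W_X(0) and
  W_0(0) vanish, so the determinant is l (P(l) - e R(l)). The factor l gives the zero branch.
  If R(0) is nonzero, the other branch is l = G(e) with G the local inverse of P/R; if R(0) = 0,
  it is again the zero branch, and \<alpha> = 0.

  The constants are real because P and R commute with complex conjugation. This follows from
  analytic continuation in l once the eigenfunctions are known to be real for large real l, and the
  latter is a uniqueness statement: their imaginary parts solve a real linear system, singular at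
  the sonic point, with zero data there. For large l the singular coefficient has a damping sign on both
  sides of the sonic point, so the imaginary parts vanish near it by a maximum argument and
  everywhere else by Gronwall's inequality.
\<close>

section \<open>Linear systems singular at a point\<close>

text \<open>Gronwall's inequality for the energy u^2 + m^2. On the compact interval \<open>A\<close>
  is continuous and positive, so the system can be solved for \<open>u'\<close> with bounded
  coefficients.\<close>

lemma linear_bounded_growth_zero:
  fixes u m A P R :: "real \<Rightarrow> real" and u' :: "real \<Rightarrow> real"
  assumes dv: "d \<le> v"
    and u': "\<And>s. s \<in> {d..v} \<Longrightarrow> (u has_real_derivative u' s) (at s)"
    and m': "\<And>s. s \<in> {d..v} \<Longrightarrow> (m has_real_derivative k * u s) (at s)"
    and A: "\<And>s. s \<in> {d..v} \<Longrightarrow> A s > 0"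
    and eq: "\<And>s. s \<in> {d..v} \<Longrightarrow> A s * u' s = - P s * u s + R s * m s"
    and cont: "continuous_on {d..v} A" "continuous_on {d..v} P" "continuous_on {d..v} R"
    and zero: "u d = 0" "m d = 0"
  shows "u v = 0 \<and> m v = 0"
proof -
  \<comment> \<open>\<open>B\<close> bounds the growth rate of u^2 + m^2: solve the equation for
    \<open>u'\<close> and estimate each mixed term with 2|u m| \<le> u^2 + m^2.\<close>
  define B where "B = (\<lambda>s. 2 * \<bar>P s / A s\<bar> + \<bar>R s / A s\<bar> + \<bar>k\<bar>)"
  have "continuous_on {d..v} B"
    unfolding B_def using A by (intro continuous_intros cont) fastforce+
  then have "bounded (B ` {d..v})"
    by (intro compact_imp_bounded compact_continuous_image) auto
  then obtain K where K: "\<And>s. s \<in> {d..v} \<Longrightarrow> B s \<le> K"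
    unfolding bounded_iff real_norm_def by (metis abs_le_D1 imageI)
  define g where "g = (\<lambda>s. (u s)\<^sup>2 + (m s)\<^sup>2)"
  define g' where "g' = (\<lambda>s. 2 * u s * u' s + 2 * m s * (k * u s))"
  have g'K: "g' s \<le> K * g s" if s: "s \<in> {d..v}" for s
  proof -
    have u's: "u' s = - (P s / A s) * u s + R s / A s * m s"
      using eq[OF s] A[OF s] by (simp add: field_simps)
    have um: "2 * \<bar>u s * m s\<bar> \<le> g s"
      unfolding g_def abs_mult using sum_squares_bound[of "\<bar>u s\<bar>" "\<bar>m s\<bar>"] by simp
    have "g' s = - 2 * (P s / A s) * (u s)\<^sup>2 + (R s / A s) * (2 * (u s * m s)) + k * (2 * (u s * m s))"
      unfolding g'_def u's by (simp add: power2_eq_square algebra_simps)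
    also have "\<dots> \<le> 2 * \<bar>P s / A s\<bar> * (u s)\<^sup>2 + \<bar>R s / A s\<bar> * (2 * \<bar>u s * m s\<bar>) + \<bar>k\<bar> * (2 * \<bar>u s * m s\<bar>)"
    proof (intro add_mono)
      show "- 2 * (P s / A s) * (u s)\<^sup>2 \<le> 2 * \<bar>P s / A s\<bar> * (u s)\<^sup>2"
        using abs_ge_minus_self[of "P s / A s"] by (intro mult_right_mono) (linarith | simp)+
      have *: "x * (2 * y) \<le> \<bar>x\<bar> * (2 * \<bar>y\<bar>)" for x y :: real
        by (metis abs_ge_self abs_mult abs_numeral)
      show "R s / A s * (2 * (u s * m s)) \<le> \<bar>R s / A s\<bar> * (2 * \<bar>u s * m s\<bar>)"
        "k * (2 * (u s * m s)) \<le> \<bar>k\<bar> * (2 * \<bar>u s * m s\<bar>)" by (rule *)+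
    qed
    also have "\<dots> \<le> 2 * \<bar>P s / A s\<bar> * g s + \<bar>R s / A s\<bar> * g s + \<bar>k\<bar> * g s"
      by (intro add_mono mult_left_mono um) (auto simp: g_def)
    also have "\<dots> = B s * g s" by (simp add: B_def algebra_simps)
    also have "\<dots> \<le> K * g s" by (intro mult_right_mono K s) (simp add: g_def)
    finally show ?thesis .
  qed
  have "g v * exp (- K * v) \<le> g d * exp (- K * d)"
  proof (rule DERIV_nonpos_imp_nonincreasing[OF dv])
    fix s assume "d \<le> s" "s \<le> v"
    then have s: "s \<in> {d..v}" by simp
    have "((\<lambda>s. g s * exp (- K * s)) has_real_derivative (g' s - K * g s) * exp (- K * s)) (at s)"
      unfolding g_def g'_def
      by (rule derivative_eq_intros u'[OF s] m'[OF s] refl)+ (simp add: algebra_simps power2_eq_square)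
    moreover have "(g' s - K * g s) * exp (- K * s) \<le> 0"
      using g'K[OF s] by (simp add: mult_le_0_iff)
    ultimately show "\<exists>y. ((\<lambda>s. g s * exp (- K * s)) has_real_derivative y) (at s) \<and> y \<le> 0" by blast
  qed
  then have "g v \<le> 0" by (simp add: g_def zero mult_le_0_iff)
  then show ?thesis unfolding g_def by (simp add: sum_power2_le_zero_iff)
qed

text \<open>Since \<open>A\<close> may vanish at 0, Gronwall's inequality cannot start there. The
  sign of \<open>P 0\<close> replaces it: at a positive maximum of |u| on a short interval [0,d] one
  has u u' \<ge> 0, whereas -P u^2 dominates R m u, because \<open>m\<close> starts at 0 and is at
  most of size d max|u|. From \<open>d\<close> onwards the system is regular.\<close>

lemma singular_linear_system_zero:
  fixes u m A P R u' :: "real \<Rightarrow> real"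
  assumes u': "\<And>s. s \<in> {0<..<b} \<Longrightarrow> (u has_real_derivative u' s) (at s)"
    and m': "\<And>s. s \<in> {0<..<b} \<Longrightarrow> (m has_real_derivative k * u s) (at s)"
    and A: "\<And>s. s \<in> {0<..<b} \<Longrightarrow> A s > 0"
    and eq: "\<And>s. s \<in> {0<..<b} \<Longrightarrow> A s * u' s = - P s * u s + R s * m s"
    and cont: "continuous_on {0..<b} u" "continuous_on {0..<b} m" "continuous_on {0..<b} A"
      "continuous_on {0..<b} P" "continuous_on {0..<b} R"
    and zero: "m 0 = 0" "u 0 = 0" and P0: "P 0 > 0" and v: "v \<in> {0..<b}"
  shows "u v = 0 \<and> m v = 0"
proof -
  have b: "b > 0" using v by auto
  have "continuous (at 0 within {0..<b}) P" using cont(4) b by (auto simp: continuous_on_eq_continuous_within)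
  then have "\<forall>\<^sub>F s in at 0 within {0..<b}. P s > P 0 / 2"
    unfolding continuous_within by (rule order_tendstoD) (use P0 in auto)
  then obtain e where e: "e > 0" and e': "\<And>s. s \<in> {0..<b} \<Longrightarrow> s \<noteq> 0 \<Longrightarrow> s < e \<Longrightarrow> P s > P 0 / 2"
    unfolding eventually_at by (auto simp: dist_real_def)
  have "bounded (R ` {0..b/2})"
    by (intro compact_imp_bounded compact_continuous_image continuous_on_subset[OF cont(5)]) (use b in auto)
  then obtain r0 where r0: "\<And>s. s \<in> {0..b/2} \<Longrightarrow> \<bar>R s\<bar> \<le> r0"
    unfolding bounded_iff real_norm_def by blast
  define r where "r = (\<bar>r0\<bar> + 1) * (\<bar>k\<bar> + 1)"
  have r: "r > 0" unfolding r_def by (intro mult_pos_pos) auto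
  \<comment> \<open>The bound b/2 keeps [0,d] where \<open>R\<close> is bounded by
    \<open>r0\<close>, e/2 keeps P > P(0)/2, and the last bound makes the coupling term |R m u| at
    most (P(0)/4) u^2 at the maximum. The summands 1 in \<open>r\<close> only make it
    positive.\<close>
  define d where "d = Min {b / 2, e / 2, P 0 / (4 * r)}"
  have d: "d > 0" "d \<le> b / 2" "d \<le> e / 2" "d \<le> P 0 / (4 * r)"
    unfolding d_def using b e P0 r by auto
  have m_bound: "\<bar>m s\<bar> \<le> \<bar>k\<bar> * M * s" if s: "s \<in> {0<..d}" and M: "\<And>t. t \<in> {0..d} \<Longrightarrow> \<bar>u t\<bar> \<le> M" for s M
  proof -
    obtain z where z: "0 < z" "z < s" "m s - m 0 = k * u z * (s - 0)"
    proof (rule mvt[of 0 s m "\<lambda>z. (*) (k * u z)"])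
      show "continuous_on {0..s} m" using s d(2) b by (intro continuous_on_subset[OF cont(2)]) force
      show "(m has_derivative (*) (k * u z)) (at z)" if "0 < z" "z < s" for z
        using m'[of z] that s d b by (auto simp: has_field_derivative_def)
    qed (use s in auto)
    have "\<bar>m s\<bar> = s * (\<bar>k\<bar> * \<bar>u z\<bar>)" using z zero by (simp add: abs_mult)
    also have "\<dots> \<le> s * (\<bar>k\<bar> * M)" by (intro mult_left_mono M) (use z that in auto)
    finally show ?thesis by (simp add: mult_ac)
  qed
  have "compact {0..d}" by simp
  moreover have "continuous_on {0..d} (\<lambda>s. \<bar>u s\<bar>)"
    by (intro continuous_intros continuous_on_subset[OF cont(1)]) (use d b in auto)
  ultimately obtain t where t: "t \<in> {0..d}" "\<And>s. s \<in> {0..d} \<Longrightarrow> \<bar>u s\<bar> \<le> \<bar>u t\<bar>"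
    using continuous_attains_sup[of "{0..d}" "\<lambda>s. \<bar>u s\<bar>"] d by auto
  have ut: "u t = 0"
  proof (rule ccontr)
    assume nz: "u t \<noteq> 0"
    then have tpos: "t > 0" using t zero by (cases "t = 0") auto
    have tb: "t \<in> {0<..<b}" using t d b tpos by auto
    have "((\<lambda>s. (u s)\<^sup>2) has_real_derivative 2 * u t * u' t) (at t)"
      by (rule derivative_eq_intros u'[OF tb] refl)+ simp
    \<comment> \<open>The maximum may sit at the right end \<open>d\<close>, so the derivative need
      not vanish. Comparison with points to the left of \<open>t\<close> still excludes a negative
      one.\<close>
    then have "0 \<le> 2 * u t * u' t"
    proof (rule contrapos_pp)
      assume "\<not> 0 \<le> 2 * u t * u' t"
      show "\<not> ((\<lambda>s. (u s)\<^sup>2) has_real_derivative 2 * u t * u' t) (at t)"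
      proof
        assume "((\<lambda>s. (u s)\<^sup>2) has_real_derivative 2 * u t * u' t) (at t)"
        from DERIV_neg_dec_left[OF this] obtain \<epsilon> where
          \<epsilon>: "\<epsilon> > 0" "\<And>h. h > 0 \<Longrightarrow> h < \<epsilon> \<Longrightarrow> (u t)\<^sup>2 < (u (t - h))\<^sup>2"
          using \<open>\<not> 0 \<le> 2 * u t * u' t\<close> by auto
        define h where "h = min (\<epsilon> / 2) t"
        have "(u t)\<^sup>2 < (u (t - h))\<^sup>2" using \<epsilon> tpos by (auto simp: h_def)
        moreover have "\<bar>u (t - h)\<bar> \<le> \<bar>u t\<bar>" by (rule t(2)) (use t \<epsilon> tpos in \<open>auto simp: h_def\<close>)
        ultimately show False by (meson abs_le_square_iff linorder_not_less)
      qed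
    qed
    then have 1: "0 \<le> u t * (A t * u' t)"
      using A[OF tb] by (metis (no_types, opaque_lifting) mult.assoc mult.left_commute zero_le_mult_iff less_imp_le zero_less_numeral mult_le_cancel_left_pos mult_zero_right)
    have "u t * (A t * u' t) = - P t * (u t)\<^sup>2 + R t * m t * u t"
      unfolding eq[OF tb] by (simp add: algebra_simps power2_eq_square)
    also have "R t * m t * u t \<le> \<bar>R t\<bar> * \<bar>m t\<bar> * \<bar>u t\<bar>" by (metis abs_ge_self abs_mult)
    also have "\<dots> \<le> \<bar>r0\<bar> * (\<bar>k\<bar> * \<bar>u t\<bar> * d) * \<bar>u t\<bar>"
    proof (intro mult_right_mono mult_mono)
      show "\<bar>R t\<bar> \<le> \<bar>r0\<bar>" using r0[of t] t d by force
      have "\<bar>m t\<bar> \<le> \<bar>k\<bar> * \<bar>u t\<bar> * t" using m_bound[of t "\<bar>u t\<bar>"] t tpos by auto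
      also have "\<dots> \<le> \<bar>k\<bar> * \<bar>u t\<bar> * d" using t by (intro mult_left_mono) auto
      finally show "\<bar>m t\<bar> \<le> \<bar>k\<bar> * \<bar>u t\<bar> * d" .
    qed auto
    also have "\<dots> = (\<bar>r0\<bar> * \<bar>k\<bar> * d) * (u t)\<^sup>2" by (simp add: power2_eq_square algebra_simps)
    also have "\<dots> \<le> (P 0 / 4) * (u t)\<^sup>2"
    proof (intro mult_right_mono)
      have "\<bar>r0\<bar> * \<bar>k\<bar> * d \<le> r * d" unfolding r_def using d by (intro mult_right_mono mult_mono) auto
      also have "\<dots> \<le> r * (P 0 / (4 * r))" using d r by (intro mult_left_mono) auto
      finally show "\<bar>r0\<bar> * \<bar>k\<bar> * d \<le> P 0 / 4" using r by simp
    qed auto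
    finally have 2: "0 \<le> (P 0 / 4 - P t) * (u t)\<^sup>2" using 1 by (simp add: algebra_simps)
    have "P t > P 0 / 2" using e' t d e b tpos by auto
    then have "(P 0 / 4 - P t) * (u t)\<^sup>2 < 0" using P0 nz by (intro mult_neg_pos) auto
    then show False using 2 by simp
  qed
  then have small: "u s = 0 \<and> m s = 0" if "s \<in> {0..d}" for s
    using t(2) m_bound[of s 0] that zero(1) by (cases "s = 0") fastforce+
  show ?thesis
  proof (cases "v \<le> d")
    case True then show ?thesis using small v by auto
  next
    case False
    have sub: "{d..v} \<subseteq> {0<..<b}" "{d..v} \<subseteq> {0..<b}" using d v by auto
    \<comment> \<open>The data at \<open>d\<close> are zero by \<open>small\<close>, and
      \<open>A\<close> is positive on the whole of [d,v].\<close>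
    show ?thesis
    proof (rule linear_bounded_growth_zero[of d v u u' m k A P R])
      show "continuous_on {d..v} A" "continuous_on {d..v} P" "continuous_on {d..v} R"
        using cont sub(2) by (auto intro: continuous_on_subset)
    qed (use False sub(1) u' m' A eq small d in \<open>auto simp: subset_iff\<close>)
  qed
qed

section \<open>Conjugation-symmetric functions and the root curve\<close>

text \<open>The Schwarz reflection property. It carries the reality of the constants: a holomorphic
  function with this property has real Taylor coefficients at 0.\<close>

definition cnj_symmetric_on :: "(complex \<Rightarrow> complex) \<Rightarrow> complex set \<Rightarrow> bool" where
  "cnj_symmetric_on f S \<longleftrightarrow> (\<forall>z\<in>S. cnj z \<in> S \<and> f (cnj z) = cnj (f z))"

lemma cnj_symmetric_on_real:
  assumes "cnj_symmetric_on f S" "of_real x \<in> S"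
  shows "f (of_real x) \<in> \<real>"
  using assms unfolding cnj_symmetric_on_def by (metis Reals_cnj_iff complex_cnj_complex_of_real)

text \<open>The identity theorem applied to f(z) - cnj(f(cnj z)), which vanishes on the real set
  \<open>U\<close>.\<close>

lemma cnj_symmetric_on_continuation:
  assumes holo: "f holomorphic_on S" and S: "open S" "connected S" "\<And>z. z \<in> S \<Longrightarrow> cnj z \<in> S"
    and U: "U \<subseteq> S" "a \<in> S" "a islimpt U" "U \<subseteq> \<real>" and real: "\<And>z. z \<in> U \<Longrightarrow> f z \<in> \<real>"
  shows "cnj_symmetric_on f S"
proof -
  have img: "cnj ` S = S" using S(3) by (metis complex_cnj_cnj image_iff subsetI subset_antisym image_subsetI)
  have "(\<lambda>z. f z - (cnj \<circ> f \<circ> cnj) z) holomorphic_on S"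
    by (intro holomorphic_on_diff holo holomorphic_on_compose_cnj_cnj) (use holo S(1) img in auto)
  moreover have "f z - (cnj \<circ> f \<circ> cnj) z = 0" if "z \<in> U" for z
    using real[OF that] U(4) that by (auto simp: Reals_cnj_iff subset_iff)
  ultimately have *: "f z - (cnj \<circ> f \<circ> cnj) z = 0" if "z \<in> S" for z
    using analytic_continuation[OF _ S(1,2) U(1,2,3)] that by blast
  show ?thesis unfolding cnj_symmetric_on_def using *[of "cnj _"] S(3) by fastforce
qed

text \<open>The quotient \<open>g\<close> extends over 0 by removal of the singularity. Away from 0
  it inherits the symmetry from \<open>f\<close>; at 0 the symmetry follows by passing to the limit.
  Iteration yields Taylor expansions with real coefficients and a symmetric remainder.\<close>

lemma cnj_symmetric_on_first_order:
  assumes holo: "f holomorphic_on S" and S: "open S" "0 \<in> S" and sym: "cnj_symmetric_on f S"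
  obtains g where "g holomorphic_on S" "cnj_symmetric_on g S" "\<forall>z\<in>S. f z = f 0 + z * g z"
    "g 0 = deriv f 0"
proof -
  define g where "g = (\<lambda>z. if z = 0 then deriv f 0 else (f z - f 0) / (z - 0))"
  have g: "g holomorphic_on S" unfolding g_def by (rule pole_lemma_open[OF holo S(1)])
  have f0: "cnj (f 0) = f 0" using sym S(2) unfolding cnj_symmetric_on_def by (metis complex_cnj_zero)
  have g_sym: "g (cnj z) = cnj (g z)" if "z \<in> S" "z \<noteq> 0" for z
    using that sym f0 by (auto simp: g_def cnj_symmetric_on_def)
  have "isCont g 0" using g S continuous_on_interior holomorphic_on_imp_continuous_on interior_open by metis
  then have lim: "g \<midarrow>0\<rightarrow> g 0" by (simp add: isCont_def)
  have "((\<lambda>z. g (cnj z)) \<longlongrightarrow> g 0) (at 0)"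
    by (rule isCont_tendsto_compose[OF \<open>isCont g 0\<close>]) (use tendsto_cnj[OF tendsto_ident_at, of 0 UNIV] in simp)
  moreover have "\<forall>\<^sub>F z in at 0. g (cnj z) = cnj (g z)"
    using eventually_at_in_open[OF S] by eventually_elim (use g_sym in auto)
  ultimately have "((\<lambda>z. cnj (g z)) \<longlongrightarrow> g 0) (at 0)" by (rule Lim_transform_eventually)
  moreover have "((\<lambda>z. cnj (g z)) \<longlongrightarrow> cnj (g 0)) (at 0)" by (intro tendsto_cnj lim)
  ultimately have "cnj (g 0) = g 0" using tendsto_unique trivial_limit_at by blast
  then have "cnj_symmetric_on g S"
    using g_sym sym unfolding cnj_symmetric_on_def by (metis complex_cnj_zero)
  then show ?thesis using that[of g] g by (auto simp: g_def)
qed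

section \<open>Real analytic functions on intervals\<close>

lemma holomorphic_imp_real_analytic_imag_axis:
  assumes "K holomorphic_on ball 0 d"
  shows "(\<lambda>x. K (\<i> * of_real x)) real_analytic_on {-d<..<d}"
  unfolding real_analytic_on_def
proof
  fix x0 assume x0: "x0 \<in> {-d<..<d}"
  \<comment> \<open>This radius keeps the disc about i x0 inside \<open>ball 0 d\<close>. The powers
    of \<i> in \<open>a\<close> turn the expansion in i(x - x0) into one in x - x0.\<close>
  define r where "r = d - \<bar>x0\<bar>"
  define a where "a n = (deriv ^^ n) K (\<i> * of_real x0) / fact n * \<i> ^ n" for n
  have "ball (\<i> * of_real x0) r \<subseteq> ball (0::complex) d"
  proof
    fix z assume "z \<in> ball (\<i> * complex_of_real x0) r"
    then have "norm (z - \<i> * of_real x0) < r" by (simp add: dist_norm norm_minus_commute)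
    moreover have "norm z \<le> norm (z - \<i> * of_real x0) + norm (\<i> * of_real x0)"
      using norm_triangle_ineq[of "z - \<i> * of_real x0" "\<i> * of_real x0"] by simp
    ultimately show "z \<in> ball 0 d" by (simp add: r_def norm_mult)
  qed
  then have holo: "K holomorphic_on ball (\<i> * of_real x0) r" using assms holomorphic_on_subset by blast
  have "(\<lambda>n. a n * complex_of_real (x - x0) ^ n) sums K (\<i> * of_real x)" if "\<bar>x - x0\<bar> < r" for x
  proof -
    have diff: "\<i> * of_real x - \<i> * of_real x0 = \<i> * complex_of_real (x - x0)"
      by (simp add: right_diff_distrib)
    have "dist (\<i> * of_real x0) (\<i> * of_real x) = \<bar>x - x0\<bar>"
      by (subst dist_commute) (simp add: dist_norm diff norm_mult del: of_real_diff)
    then have "\<i> * of_real x \<in> ball (\<i> * of_real x0) r" using that by simp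
    from holomorphic_power_series[OF holo this] show ?thesis
      unfolding diff a_def power_mult_distrib by (simp only: mult.assoc)
  qed
  then show "\<exists>a r. r > 0 \<and> (\<forall>x\<in>{-d<..<d}. \<bar>x - x0\<bar> < r \<longrightarrow>
      (\<lambda>n. a n * complex_of_real (x - x0) ^ n) sums K (\<i> * of_real x))"
    using x0 by (intro exI[of _ a] exI[of _ r] conjI) (auto simp: r_def)
qed

lemma real_analytic_on_imp_continuous_on:
  assumes "f real_analytic_on S"
  shows "continuous_on S f"
  unfolding continuous_on_eq_continuous_within
proof
  fix x0 assume x0: "x0 \<in> S"
  then obtain a r where r: "r > 0"
    and a: "\<And>x. x \<in> S \<Longrightarrow> \<bar>x - x0\<bar> < r \<Longrightarrow> (\<lambda>n. a n * complex_of_real (x - x0) ^ n) sums f x"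
    using assms unfolding real_analytic_on_def by blast
  show "continuous (at x0 within S) f"
  \<comment> \<open>A second point \<open>y\<close> of \<open>S\<close> is what certifies a positive
    radius of convergence, hence continuity of the power series at its centre. Without such a point
    \<open>x0\<close> is isolated in \<open>S\<close>.\<close>
  proof (cases "\<exists>y\<in>S. y \<noteq> x0 \<and> \<bar>y - x0\<bar> < r")
    case True
    then obtain y where y: "y \<in> S" "y \<noteq> x0" "\<bar>y - x0\<bar> < r" by blast
    define g where "g = (\<lambda>z. \<Sum>n. a n * z ^ n)"
    have cont: "isCont g (complex_of_real (x0 - x0))"
      unfolding g_def by (rule isCont_powser[OF sums_summable[OF a[OF y(1,3)]]]) (use y in \<open>auto simp flip: of_real_diff\<close>)
    have "((\<lambda>x. g (complex_of_real (x - x0))) \<longlongrightarrow> g (complex_of_real (x0 - x0))) (at x0 within S)"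
      by (rule isCont_tendsto_compose[OF cont]) (intro tendsto_intros)
    moreover have "\<forall>\<^sub>F x in at x0 within S. g (complex_of_real (x - x0)) = f x"
      unfolding eventually_at
    proof (intro exI[of _ r] conjI ballI impI)
      fix x assume "x \<in> S" "x \<noteq> x0 \<and> dist x x0 < r"
      then show "g (complex_of_real (x - x0)) = f x"
        using sums_unique[OF a[of x]] by (simp add: g_def dist_real_def)
    qed (rule r)
    moreover have "g (complex_of_real (x0 - x0)) = f x0" using sums_unique[OF a[OF x0]] r by (simp add: g_def)
    ultimately show ?thesis unfolding continuous_within using Lim_transform_eventually by fastforce
  next
    case False
    then have "at x0 within S = bot"
      unfolding trivial_limit_within islimpt_approachable using r by (auto simp: dist_real_def)
    then show ?thesis by simp
  qed
qed

section \<open>The nontrivial branch of the root set\<close>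

text \<open>The curve is written as a function of z = i \<xi> because exp(z X), unlike exp(i \<xi>
  X) as a function of \<xi>, commutes with conjugation. The conclusion that \<open>K\<close>
  vanishes identically when \<open>R 0 = 0\<close> is needed later: with a zero linear coefficient
  the factored expansion can represent only the zero curve.\<close>

lemma Bloch_root_curve:
  fixes P R :: "complex \<Rightarrow> complex" and X :: real
  assumes holo: "P holomorphic_on S" "R holomorphic_on S" and S: "open S" "0 \<in> S"
    and sym: "cnj_symmetric_on P S" "cnj_symmetric_on R S"
    and eq0: "P 0 = R 0" and ne: "deriv P 0 \<noteq> deriv R 0"
  obtains K d where "d > 0" "K holomorphic_on ball 0 d" "cnj_symmetric_on K (ball 0 d)" "K 0 = 0"
    "deriv K 0 = of_real X * R 0 / (deriv P 0 - deriv R 0)"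
    "R 0 = 0 \<Longrightarrow> K = (\<lambda>_. 0)"
    "\<forall>\<^sub>F (l, \<xi>) in nhds (0, 0). P l = exp (\<i> * of_real (\<xi> * X)) * R l \<longleftrightarrow> l = K (\<i> * of_real \<xi>)"
proof (cases "R 0 = 0")
  case True
  obtain p where p: "p holomorphic_on S" "cnj_symmetric_on p S" "\<forall>z\<in>S. P z = P 0 + z * p z" "p 0 = deriv P 0"
    by (rule cnj_symmetric_on_first_order[OF holo(1) S sym(1)]) (rule that)
  obtain r where r: "r holomorphic_on S" "cnj_symmetric_on r S" "\<forall>z\<in>S. R z = R 0 + z * r z" "r 0 = deriv R 0"
    by (rule cnj_symmetric_on_first_order[OF holo(2) S sym(2)]) (rule that)
  \<comment> \<open>\<open>P\<close> and \<open>R\<close> both vanish at 0 here, so dividing the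
    root equation by \<open>l\<close> leaves \<open>G\<close>. Its value at (0,0) is P'(0) - R'(0),
    which is nonzero; by continuity \<open>l = 0\<close> is the only root nearby.\<close>
  define G where "G = (\<lambda>(l, \<xi>::real). p l - exp (\<i> * of_real (\<xi> * X)) * r l)"
  have cont: "continuous_on (S \<times> UNIV) (\<lambda>y::complex \<times> real. p (fst y))"
    "continuous_on (S \<times> UNIV) (\<lambda>y::complex \<times> real. r (fst y))"
    by (rule continuous_on_compose2[OF holomorphic_on_imp_continuous_on continuous_on_fst[OF continuous_on_id]],
        rule p r, force)+
  have "continuous_on (S \<times> UNIV) G"
    unfolding G_def split_def
    using cont by (intro continuous_intros)
  then have "open ((S \<times> UNIV) \<inter> G -` (- {0}))"
    by (rule continuous_open_preimage) (simp_all add: open_Times S(1) open_Compl)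
  moreover have "(0, 0) \<in> (S \<times> UNIV) \<inter> G -` (- {0})"
    using S(2) p(4) r(4) ne by (simp add: G_def)
  ultimately have "\<forall>\<^sub>F y in nhds (0, 0). y \<in> (S \<times> UNIV) \<inter> G -` (- {0})"
    by (rule eventually_nhds_in_open)
  then have ev: "\<forall>\<^sub>F (l, \<xi>) in nhds (0, 0). P l = exp (\<i> * of_real (\<xi> * X)) * R l \<longleftrightarrow> l = 0"
  proof eventually_elim
    case (elim y)
    obtain l \<xi> where y: "y = (l, \<xi>)" by fastforce
    have l: "l \<in> S" and G: "G (l, \<xi>) \<noteq> 0" using elim by (simp_all add: y)
    have "P l = l * p l" "R l = l * r l" using bspec[OF p(3) l] bspec[OF r(3) l] True eq0 by simp_all
    then have "P l - exp (\<i> * of_real (\<xi> * X)) * R l = l * G (l, \<xi>)"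
      by (simp add: G_def right_diff_distrib)
    then have "P l = exp (\<i> * of_real (\<xi> * X)) * R l \<longleftrightarrow> l * G (l, \<xi>) = 0"
      by (metis right_minus_eq)
    then show ?case using G by (simp add: y)
  qed
  show ?thesis
  proof (rule that[of 1 "\<lambda>_. 0"])
    show "cnj_symmetric_on (\<lambda>_. 0) (ball 0 1)" by (simp add: cnj_symmetric_on_def)
    show "\<forall>\<^sub>F (l, \<xi>) in nhds (0, 0). P l = exp (\<i> * of_real (\<xi> * X)) * R l \<longleftrightarrow> l = 0" by (rule ev)
  qed (simp_all add: True)
next
  case False
  \<comment> \<open>Away from the zeros of \<open>R\<close> the root equation reads P/R = exp(i
    \<xi> X). The quotient equals 1 at 0 and has nonzero derivative (P'(0) - R'(0))/R(0) there, so
    it is locally invertible.\<close>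
  define T where "T = S \<inter> R -` (- {0})"
  have T: "open T" "0 \<in> T" "T \<subseteq> S"
    unfolding T_def using S False continuous_open_preimage[OF holomorphic_on_imp_continuous_on[OF holo(2)], of "- {0}"]
    by auto
  define f where "f = (\<lambda>z. P z / R z)"
  have f: "f holomorphic_on T"
    unfolding f_def by (intro holomorphic_intros holomorphic_on_subset[OF holo(1) T(3)]
        holomorphic_on_subset[OF holo(2) T(3)]) (auto simp: T_def)
  have f0: "f 0 = 1" using False eq0 by (simp add: f_def)
  have dP: "(P has_field_derivative deriv P 0) (at 0)" and dR: "(R has_field_derivative deriv R 0) (at 0)"
    by (rule holomorphic_derivI[OF _ S], rule holo)+
  have "(f has_field_derivative (deriv P 0 * R 0 - P 0 * deriv R 0) / (R 0 * R 0)) (at 0)"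
    unfolding f_def by (rule DERIV_divide[OF dP dR False])
  moreover have "deriv P 0 * R 0 - P 0 * deriv R 0 = (deriv P 0 - deriv R 0) * R 0"
    by (simp add: eq0 algebra_simps)
  ultimately have "(f has_field_derivative (deriv P 0 - deriv R 0) / R 0) (at 0)"
    using False by simp
  then have df0: "deriv f 0 = (deriv P 0 - deriv R 0) / R 0" by (rule DERIV_imp_deriv)
  obtain e where e: "e > 0" "ball 0 e \<subseteq> T" "open (f ` ball 0 e)" "inj_on f (ball 0 e)"
    by (rule has_complex_derivative_locally_invertible[OF f T(2,1)]) (simp add: df0 ne False)
  obtain g where g: "g holomorphic_on f ` ball 0 e"
      "\<And>z. z \<in> ball 0 e \<Longrightarrow> deriv f z * deriv g (f z) = 1" "\<And>z. z \<in> ball 0 e \<Longrightarrow> g (f z) = z"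
    by (rule holomorphic_has_inverse[OF holomorphic_on_subset[OF f e(2)] open_ball e(4)]) (rule that)
  have one: "1 \<in> f ` ball 0 e" using f0 e(1) by (metis centre_in_ball imageI)
  define E where "E = (\<lambda>z::complex. exp (z * of_real X))"
  have "open (E -` (f ` ball 0 e))"
    unfolding E_def by (intro open_vimage e(3) continuous_intros)
  moreover have "0 \<in> E -` (f ` ball 0 e)" using one by (simp add: E_def)
  \<comment> \<open>\<open>d\<close> is chosen so that exp(z X) stays in the image on which the
    inverse \<open>g\<close> is defined.\<close>
  ultimately obtain d where d: "d > 0" "ball 0 d \<subseteq> E -` (f ` ball 0 e)" by (rule openE)
  define K where "K = (\<lambda>z. g (E z))"
  have E_img: "\<exists>w. w \<in> ball 0 e \<and> E z = f w \<and> K z = w" if z: "z \<in> ball 0 d" for z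
  proof -
    obtain w where "w \<in> ball 0 e" "E z = f w" using d(2) z by blast
    then show ?thesis using g(3) by (auto simp: K_def)
  qed
  have K0: "K 0 = 0" using g(3)[of 0] e(1) f0 by (simp add: K_def E_def)
  show ?thesis
  proof (rule that[of d K])
    show "K holomorphic_on ball 0 d"
    proof -
      have "E holomorphic_on ball 0 d" unfolding E_def by (intro holomorphic_intros)
      moreover have "E ` ball 0 d \<subseteq> f ` ball 0 e" using d(2) by blast
      ultimately show ?thesis
        unfolding K_def using holomorphic_on_compose_gen[OF _ g(1)] by (simp add: o_def)
    qed
    show "cnj_symmetric_on K (ball 0 d)"
      unfolding cnj_symmetric_on_def
    proof (intro ballI conjI)
      fix z :: complex assume z: "z \<in> ball 0 d"
      then show "cnj z \<in> ball 0 d" by simp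
      obtain w where w: "w \<in> ball 0 e" "E z = f w" "K z = w" using E_img[OF z] by blast
      \<comment> \<open>The local inverse inherits the symmetry of \<open>f\<close>: exp(X cnj z) is
        the image under \<open>f\<close> of cnj w, and cnj w lies again in the disc where
        \<open>g\<close> inverts \<open>f\<close>.\<close>
      have "E (cnj z) = cnj (E z)" by (simp add: E_def exp_cnj)
      also have "\<dots> = f (cnj w)"
        using w e(2) T(3) sym by (auto simp: f_def cnj_symmetric_on_def subset_iff)
      finally show "K (cnj z) = cnj (K z)" using g(3)[of "cnj w"] w by (simp add: K_def)
    qed
    show "K 0 = 0" by (rule K0)
    have "(g has_field_derivative deriv g 1) (at (E 0))"
      using holomorphic_derivI[OF g(1) e(3) one] by (simp add: E_def)
    moreover have "(E has_field_derivative of_real X) (at 0)"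
      unfolding E_def by (auto intro!: derivative_eq_intros)
    ultimately have "(K has_field_derivative deriv g 1 * of_real X) (at 0)"
      unfolding K_def by (rule DERIV_chain2)
    moreover have "deriv g 1 = R 0 / (deriv P 0 - deriv R 0)"
    proof -
      have "deriv f 0 * deriv g 1 = 1" using g(2)[of 0] e(1) f0 by simp
      then have "deriv g 1 = inverse (deriv f 0)" by (metis inverse_unique)
      then show ?thesis by (simp add: df0)
    qed
    ultimately show "deriv K 0 = of_real X * R 0 / (deriv P 0 - deriv R 0)"
      by (simp add: DERIV_imp_deriv)
    have "\<forall>\<^sub>F y in nhds (0, 0). y \<in> ball (0::complex) e \<times> ball (0::real) d"
      by (rule eventually_nhds_in_open) (use e d in \<open>auto intro: open_Times\<close>)
    then show "\<forall>\<^sub>F (l, \<xi>) in nhds (0, 0). P l = exp (\<i> * of_real (\<xi> * X)) * R l \<longleftrightarrow> l = K (\<i> * of_real \<xi>)"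
    proof eventually_elim
      case (elim y)
      then obtain l \<xi> where y: "y = (l, \<xi>)" "l \<in> ball 0 e" "\<xi> \<in> ball 0 d" by blast
      then have "\<i> * of_real \<xi> \<in> ball 0 d" by (simp add: norm_mult)
      then obtain w where w: "w \<in> ball 0 e" "E (\<i> * of_real \<xi>) = f w" "K (\<i> * of_real \<xi>) = w"
        using E_img by blast
      have "R l \<noteq> 0" using y(2) e(2) by (auto simp: T_def)
      then have "P l = exp (\<i> * of_real (\<xi> * X)) * R l \<longleftrightarrow> f l = E (\<i> * of_real \<xi>)"
        unfolding f_def E_def by (simp add: nonzero_divide_eq_eq mult.assoc)
      also have "\<dots> \<longleftrightarrow> l = K (\<i> * of_real \<xi>)"
        using w y(2) e(4) by (auto dest: inj_onD)
      finally show ?case by (simp add: y)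
    qed
    show "d > 0" by (rule d(1))
    show "K = (\<lambda>_. 0)" if "R 0 = 0" using that False by simp
  qed
qed

section \<open>Cancelling the factor given by the spectral parameter\<close>

text \<open>Only the point 0 needs an argument, and there continuity supplies it. This determines
  the reduced determinant at 0 although the factorization gives no information there
  directly.\<close>

lemma holomorphic_cancel_ident:
  assumes "f holomorphic_on S" "g holomorphic_on S" "open S" "0 \<in> S"
    and eq: "\<And>z. z \<in> S \<Longrightarrow> z * f z = z * g z" and z: "z \<in> S"
  shows "f z = (g z :: complex)"
proof (cases "z = 0")
  case False
  then show ?thesis using eq[OF z] by simp
next
  case True
  have cont: "isCont f 0" "isCont g 0"
    using holomorphic_on_imp_continuous_on[OF assms(1)] holomorphic_on_imp_continuous_on[OF assms(2)] assms(4)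
    by (simp_all add: continuous_on_eq_continuous_at[OF assms(3)])
  have "\<forall>\<^sub>F w in at 0. f w = g w"
    using eventually_at_in_open[OF assms(3,4)]
  proof eventually_elim
    case (elim w)
    then show ?case using eq[of w] by simp
  qed
  moreover have "f \<midarrow>0\<rightarrow> f 0" using cont(1) by (simp add: isCont_def)
  ultimately have "g \<midarrow>0\<rightarrow> f 0" by (rule Lim_transform_eventually[rotated])
  moreover have "g \<midarrow>0\<rightarrow> g 0" using cont(2) by (simp add: isCont_def)
  ultimately show ?thesis unfolding True using LIM_unique by blast
qed

text \<open>Order two means f(w) = w^2 k(w) with k(0) nonzero. Cancelling one factor w leaves g(w) =
  w k(w), whose derivative at 0 is k(0).\<close>

lemma double_root_ident_factor:
  assumes g: "g holomorphic_on S" and S: "open S" "connected S" "0 \<in> S"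
    and f: "\<And>z. z \<in> S \<Longrightarrow> f z = z * g z" and mult: "root_of_multiplicity f 0 2"
  shows "g 0 = 0 \<and> deriv g 0 \<noteq> 0"
proof -
  have holo: "f holomorphic_on S"
    by (rule holomorphic_transform[of "\<lambda>z. z * g z"]) (use g f in \<open>auto intro: holomorphic_intros\<close>)
  have freq: "\<exists>\<^sub>F w in at 0. f w \<noteq> 0" and order: "zorder f 0 = 2"
    using mult by (simp_all add: root_of_multiplicity_def)
  \<comment> \<open>The frequently clause of the multiplicity excludes that \<open>f\<close>
    vanishes identically, as the local factorization by \<open>zorder\<close> requires.\<close>
  have "\<exists>w\<in>S. f w \<noteq> 0"
    using frequently_ex[OF frequently_eventually_frequently[OF freq eventually_at_in_open'[OF S(1,3)]]] by blast
  from zorder_exist_zero[OF holo S this]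
  obtain r where r: "r > 0" "cball 0 r \<subseteq> S" "zor_poly f 0 holomorphic_on cball 0 r"
    "\<forall>w\<in>cball 0 r. f w = zor_poly f 0 w * (w - 0) ^ nat (zorder f 0) \<and> zor_poly f 0 w \<noteq> 0" by blast
  define k where "k = zor_poly f 0"
  have k_holo: "k holomorphic_on ball 0 r"
    unfolding k_def using r(3) by (rule holomorphic_on_subset) simp
  have k: "f w = w * (w * k w)" "k w \<noteq> 0" if "w \<in> ball 0 r" for w
    using bspec[OF r(4), of w] that unfolding k_def order by (simp_all add: power2_eq_square mult_ac)
  have sub: "ball 0 r \<subseteq> S" using r(2) by auto
  have gk: "g w = w * k w" if "w \<in> ball 0 r" for w
  proof (rule holomorphic_cancel_ident[OF _ _ open_ball _ _ that])
    show "g holomorphic_on ball 0 r" using g sub holomorphic_on_subset by blast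
    show "(\<lambda>w. w * k w) holomorphic_on ball 0 r" by (intro holomorphic_intros k_holo)
    show "z * g z = z * (z * k z)" if "z \<in> ball 0 r" for z
      using f[of z] k(1)[OF that] sub that by auto
  qed (use r in auto)
  have "(k has_field_derivative deriv k 0) (at 0)"
    by (rule holomorphic_derivI[OF k_holo open_ball]) (use r(1) in auto)
  from DERIV_mult[OF DERIV_ident this] have "((\<lambda>w. w * k w) has_field_derivative k 0) (at 0)" by simp
  then have "(g has_field_derivative k 0) (at 0)"
    by (rule has_field_derivative_transform_within_open[of _ _ _ "ball 0 r"]) (use gk r(1) in auto)
  then show ?thesis using gk[of 0] k(2)[of 0] r(1) by (simp add: DERIV_imp_deriv)
qed

text \<open>With z = i \<xi>, expanding K(z) = k1 z + k2 z^2 + z^3 T(z) and comparing with -z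
  \<alpha> (1 - z \<gamma> + r) gives \<alpha> = -k1 and \<gamma> = -k2/k1. The symmetry of
  \<open>K\<close> makes k1 and k2 real. The second curve is the root \<open>l = 0\<close> of the
  explicit factor.\<close>

lemma two_root_curves:
  fixes P R :: "complex \<Rightarrow> complex" and \<Delta> :: "complex \<Rightarrow> real \<Rightarrow> complex" and X :: real
  assumes PR: "P holomorphic_on S" "R holomorphic_on S" "open S" "0 \<in> S"
      "cnj_symmetric_on P S" "cnj_symmetric_on R S" "P 0 = R 0" "deriv P 0 \<noteq> deriv R 0"
    and X: "X \<noteq> 0"
    and \<Delta>: "\<And>l \<xi>. l \<in> S \<Longrightarrow> \<Delta> l \<xi> = l * (P l - exp (\<i> * of_real (\<xi> * X)) * R l)"
  shows "\<exists>(lam1 :: real \<Rightarrow> complex) (lam2 :: real \<Rightarrow> complex) (\<alpha> :: real) (\<gamma> :: real)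
        (r :: real \<Rightarrow> complex) (\<delta> :: real).
       \<delta> > 0 \<and>
       lam1 real_analytic_on {-\<delta><..<\<delta>} \<and> lam2 real_analytic_on {-\<delta><..<\<delta>} \<and>
       (\<forall>\<^sub>F (l, \<xi>) in nhds (0, 0). \<Delta> l \<xi> = 0 \<longleftrightarrow> l = lam1 \<xi> \<or> l = lam2 \<xi>) \<and>
       r \<in> O[at 0](\<lambda>\<xi>. of_real (\<xi>\<^sup>2)) \<and>
       (\<forall>\<xi>. \<bar>\<xi>\<bar> < \<delta> \<longrightarrow>
          lam1 \<xi> = - \<i> * of_real \<xi> * of_real \<alpha> * (1 - \<i> * of_real \<xi> * of_real \<gamma> + r \<xi>) \<and>
          lam2 \<xi> = 0) \<and>
       of_real \<alpha> = - of_real X * R 0 / (deriv P 0 - deriv R 0)"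
proof -
  obtain K d where d: "d > 0" and K: "K holomorphic_on ball 0 d" "cnj_symmetric_on K (ball 0 d)" "K 0 = 0"
    "deriv K 0 = of_real X * R 0 / (deriv P 0 - deriv R 0)"
    and K_zero: "R 0 = 0 \<Longrightarrow> K = (\<lambda>_. 0)"
    and root: "\<forall>\<^sub>F (l, \<xi>) in nhds (0, 0). P l = exp (\<i> * of_real (\<xi> * X)) * R l \<longleftrightarrow> l = K (\<i> * of_real \<xi>)"
    by (rule Bloch_root_curve[OF PR, of X]) (rule that)
  have ball: "open (ball (0::complex) d)" "0 \<in> ball (0::complex) d" using d by auto
  obtain K1 where K1: "K1 holomorphic_on ball 0 d" "cnj_symmetric_on K1 (ball 0 d)"
      "\<forall>z\<in>ball 0 d. K z = K 0 + z * K1 z" "K1 0 = deriv K 0"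
    by (rule cnj_symmetric_on_first_order[OF K(1) ball K(2)]) (rule that)
  obtain K2 where K2: "K2 holomorphic_on ball 0 d" "cnj_symmetric_on K2 (ball 0 d)"
      "\<forall>z\<in>ball 0 d. K1 z = K1 0 + z * K2 z" "K2 0 = deriv K1 0"
    by (rule cnj_symmetric_on_first_order[OF K1(1) ball K1(2)]) (rule that)
  obtain T where T: "T holomorphic_on ball 0 d" "cnj_symmetric_on T (ball 0 d)"
      "\<forall>z\<in>ball 0 d. K2 z = K2 0 + z * T z" "T 0 = deriv K2 0"
    by (rule cnj_symmetric_on_first_order[OF K2(1) ball K2(2)]) (rule that)
  obtain k1 where k1: "K1 0 = of_real k1"
    using cnj_symmetric_on_real[OF K1(2), of 0] d by (auto elim: Reals_cases)
  obtain k2 where k2: "K2 0 = of_real k2"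
    using cnj_symmetric_on_real[OF K2(2), of 0] d by (auto elim: Reals_cases)
  have expand: "K z = z * (of_real k1 + z * (of_real k2 + z * T z))" if "z \<in> ball 0 d" for z
    using bspec[OF K1(3) that] bspec[OF K2(3) that] bspec[OF T(3) that] K(3) k1 k2 by simp
  \<comment> \<open>If k1 = 0, division by zero gives 0, so the remainder and \<gamma> are both 0
    and the order bound still holds.\<close>
  define r where "r = (\<lambda>\<xi>::real. (\<i> * of_real \<xi>)\<^sup>2 * T (\<i> * of_real \<xi>) / of_real k1)"
  have form: "K (\<i> * of_real \<xi>) = - \<i> * of_real \<xi> * of_real (- k1) * (1 - \<i> * of_real \<xi> * of_real (- k2 / k1) + r \<xi>)"
    if "\<bar>\<xi>\<bar> < d" for \<xi>
  proof (cases "k1 = 0")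
    case True
    \<comment> \<open>A vanishing linear coefficient forces \<open>R 0 = 0\<close>, hence the whole
      curve is zero, as the factor \<alpha> = 0 demands.\<close>
    then have "of_real X * R 0 / (deriv P 0 - deriv R 0) = 0" using k1 K1(4) K(4) by simp
    then have "R 0 = 0" using X PR(8) by simp
    then show ?thesis using K_zero True by simp
  next
    case False
    define z where "z = \<i> * complex_of_real \<xi>"
    have "z \<in> ball 0 d" using that by (simp add: z_def norm_mult)
    from expand[OF this] have "K z = z * (of_real k1 + z * (of_real k2 + z * T z))" .
    also have "of_real k1 + z * (of_real k2 + z * T z)
        = of_real k1 * (1 + z * of_real k2 / of_real k1 + z\<^sup>2 * T z / of_real k1)"
      using False by (simp add: distrib_left power2_eq_square)
    finally have "K z = z * of_real k1 * (1 + z * of_real k2 / of_real k1 + z\<^sup>2 * T z / of_real k1)"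
      by (simp only: mult.assoc)
    moreover have "- \<i> * of_real \<xi> * of_real (- k1) = z * of_real k1"
      "1 - \<i> * of_real \<xi> * of_real (- k2 / k1) + r \<xi> = 1 + z * of_real k2 / of_real k1 + z\<^sup>2 * T z / of_real k1"
      by (simp_all add: z_def r_def)
    ultimately show ?thesis by (simp only: z_def)
  qed
  have "isCont T 0" 
    using holomorphic_on_imp_continuous_on[OF T(1)] ball(2)
    by (simp add: continuous_on_eq_continuous_at[OF ball(1)])
  then have "((\<lambda>\<xi>::real. T (\<i> * of_real \<xi>)) \<longlongrightarrow> T 0) (at 0)"
    by (rule isCont_tendsto_compose) (auto intro!: tendsto_eq_intros)
  then have "((\<lambda>\<xi>::real. norm (T (\<i> * of_real \<xi>))) \<longlongrightarrow> norm (T 0)) (at 0)" by (rule tendsto_norm)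
  then have bound: "\<forall>\<^sub>F \<xi>::real in at 0. norm (T (\<i> * of_real \<xi>)) < norm (T 0) + 1"
    by (rule order_tendstoD) simp
  have bigo: "r \<in> O[at 0](\<lambda>\<xi>. of_real (\<xi>\<^sup>2))"
  proof (rule bigoI)
    show "\<forall>\<^sub>F \<xi> in at 0. norm (r \<xi>) \<le> (norm (T 0) + 1) / \<bar>k1\<bar> * norm (complex_of_real (\<xi>\<^sup>2))"
      using bound
    proof eventually_elim
      case (elim \<xi>)
      have "norm (r \<xi>) = \<xi>\<^sup>2 * norm (T (\<i> * of_real \<xi>)) / \<bar>k1\<bar>"
        by (simp add: r_def norm_mult norm_divide norm_power)
      also have "\<dots> \<le> \<xi>\<^sup>2 * (norm (T 0) + 1) / \<bar>k1\<bar>"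
        using elim by (intro divide_right_mono mult_left_mono) auto
      finally show ?case by (simp add: norm_power mult.commute del: of_real_power)
    qed
  qed
  have "\<forall>\<^sub>F y in nhds (0, 0). y \<in> S \<times> (UNIV :: real set)"
    by (rule eventually_nhds_in_open) (use PR in \<open>auto intro: open_Times\<close>)
  with root have ev: "\<forall>\<^sub>F (l, \<xi>) in nhds (0, 0). \<Delta> l \<xi> = 0 \<longleftrightarrow> l = K (\<i> * of_real \<xi>) \<or> l = 0"
  proof eventually_elim
    case (elim y)
    obtain l \<xi> where y: "y = (l, \<xi>)" by (cases y)
    have "\<Delta> l \<xi> = 0 \<longleftrightarrow> l = 0 \<or> P l = exp (\<i> * of_real (\<xi> * X)) * R l"
      using \<Delta>[of l \<xi>] elim(2) by (simp add: y)
    then show ?case using elim(1) by (auto simp: y)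
  qed
  have analytic: "(\<lambda>\<xi>. K (\<i> * of_real \<xi>)) real_analytic_on {-d<..<d}"
    by (rule holomorphic_imp_real_analytic_imag_axis[OF K(1)])
  have analytic0: "(\<lambda>_. 0) real_analytic_on {-d<..<d}"
    by (rule holomorphic_imp_real_analytic_imag_axis[of "\<lambda>_. 0"]) simp
  have "of_real (- k1) = - of_real X * R 0 / (deriv P 0 - deriv R 0)"
    using k1 K1(4) K(4) by simp
  then show ?thesis
    by (intro exI[of _ "\<lambda>\<xi>. K (\<i> * of_real \<xi>)"] exI[of _ "\<lambda>_. 0"] exI[of _ "- k1"] exI[of _ "- k2 / k1"]
        exI[of _ r] exI[of _ d] conjI allI impI) (rule d analytic analytic0 ev bigo form refl | assumption)+
qed

section \<open>Reality of the eigenfunctions\<close>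

lemma q0_pos: "F > 0 \<Longrightarrow> Hs > 0 \<Longrightarrow> q0 F Hs > 0"
  by (simp add: q0_def)

lemma q0_squared: "F > 0 \<Longrightarrow> Hs > 0 \<Longrightarrow> (q0 F Hs)\<^sup>2 * F\<^sup>2 = Hs ^ 3"
proof -
  assume "F > 0" "Hs > 0"
  have "(Hs powr (3/2))\<^sup>2 = Hs powr 3"
    unfolding power2_eq_square powr_add[symmetric] by simp
  also have "\<dots> = Hs ^ 3" using \<open>Hs > 0\<close> by (simp add: powr_numeral)
  finally show ?thesis using \<open>F > 0\<close> by (simp add: q0_def power_divide)
qed

lemma roll_wave_pos:
  assumes "F > 2" "roll_wave F Hs Hm Hp X H" "x \<in> {0..X}"
  shows "H x > 0"
proof -
  have "Hs > 0" "Hm > (1 + 2 * F + sqrt (1 + 4 * F)) / (2 * F\<^sup>2) * Hs" "H x \<ge> Hm"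
    using assms unfolding roll_wave_def by (simp_all add: image_subset_iff)
  moreover have "(1 + 2 * F + sqrt (1 + 4 * F)) / (2 * F\<^sup>2) * Hs > 0"
    using assms(1) \<open>Hs > 0\<close> by (intro mult_pos_pos divide_pos_pos add_pos_nonneg) auto
  ultimately show ?thesis by linarith
qed

lemma roll_wave_continuous_on:
  assumes "roll_wave F Hs Hm Hp X H"
  shows "continuous_on {0..X} H"
  by (rule DERIV_continuous_on) (use assms in \<open>auto simp only: roll_wave_def\<close>)

text \<open>Eliminates the discharge perturbation q = M + c u, with \<open>M\<close> the mass flux
  and Q = c H - k. What multiplies \<open>u\<close> afterwards is the coefficient that vanishes at
  the sonic point.\<close>

lemma momentum_flux_identity:
  fixes H c k F M u :: real
  assumes "H \<noteq> 0"
  shows "(2 * (c * H - k) / H - c) * (M + c * u) + (- (c * H - k)\<^sup>2 / H\<^sup>2 + H / F\<^sup>2) * u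
    = (c - 2 * k / H) * M + (H / F\<^sup>2 - k\<^sup>2 / H\<^sup>2) * u"
proof -
  define m where "m = k / H"
  have "(c * H - k) / H = c - m" using assms by (simp add: m_def diff_divide_distrib)
  then have "2 * (c * H - k) / H = 2 * (c - m)" "- (c * H - k)\<^sup>2 / H\<^sup>2 = - (c - m)\<^sup>2"
    "2 * k / H = 2 * m" "k\<^sup>2 / H\<^sup>2 = m\<^sup>2"
    unfolding times_divide_eq_right[symmetric] minus_divide_left[symmetric] power_divide[symmetric]
    by (simp_all add: m_def)
  then show ?thesis by (simp only:) (simp add: power2_eq_square algebra_simps)
qed

text \<open>Here \<open>D\<close> stands for H' and \<open>a'\<close> for the derivative of the
  coefficient of \<open>u\<close> in the reduced momentum flux. Subtracting from the momentum
  equation the derivative of (c - 2k/H) M, with M' = -l u, and the term a' u isolates a u'.\<close>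

lemma linearized_momentum_identity:
  fixes H c k l D u M a' :: real
  assumes "H \<noteq> 0"
  shows "u - 2 * (c * H - k) / H\<^sup>2 * (M + c * u) + 2 * (c * H - k)\<^sup>2 / H ^ 3 * u - l * (M + c * u)
      - (2 * k * D / H\<^sup>2 * M + (c - 2 * k / H) * (- l * u)) - a' * u
    = - (a' - 1 + 2 * (c * H - k) * k / H ^ 3 + 2 * l * k / H) * u
      + - (2 * (c * H - k) / H\<^sup>2 + l + 2 * k * D / H\<^sup>2) * M" (is "?L = ?R")
proof -
  \<comment> \<open>In terms of 1/H both sides are polynomials, and their difference has the factor
    i H - 1.\<close>
  define i where "i = inverse H"
  have i: "i * H = 1" using assms by (simp add: i_def)
  have "?L - ?R = 2 * u * (c * H - k) * i\<^sup>2 * (i * H - 1) * c"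
    unfolding divide_inverse power_inverse[symmetric] i_def[symmetric]
    by (simp add: algebra_simps power2_eq_square power3_eq_cube)
  then show ?thesis by (simp add: i)
qed

text \<open>For real \<open>l\<close> the equations and the normalization are real, so the imaginary
  parts solve the same system with zero data at the sonic point. The zero-order coefficient there
  increases linearly with \<open>l\<close>; beyond a bound independent of \<open>h\<close> and
  \<open>q\<close> it has the damping sign.\<close>

lemma eventually_real_eigenfunctions:
  assumes F: "F > 2" and rw: "roll_wave F Hs Hm Hp X H"
    and xs: "0 < xs" "xs < X" "H xs = Hs"
  obtains L where "\<And>l h q x. l > L \<Longrightarrow> continuous_on {0..X} h \<Longrightarrow> continuous_on {0..X} q \<Longrightarrow>
     eigenvalue_equations F Hs X H (of_real l) h q \<Longrightarrow> normalized_at F Hs xs (of_real l) h q \<Longrightarrow>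
     x \<in> {0..X} \<Longrightarrow> h x \<in> \<real> \<and> q x \<in> \<real>"
proof -
  define c where "c = wave_speed F Hs"
  define k where "k = q0 F Hs"
  define D where "D = (\<lambda>x. F\<^sup>2 * ((H x)\<^sup>2 + (Hs - c\<^sup>2) * H x + k\<^sup>2 / Hs) / ((H x)\<^sup>2 + Hs * H x + Hs\<^sup>2))"
  have Hs: "Hs > 0" and mono: "strict_mono_on {0..X} H"
    and dH0: "\<And>x. x \<in> {0..X} \<Longrightarrow> (H has_real_derivative D x) (at x within {0..X})"
    using rw unfolding roll_wave_def D_def c_def k_def by auto
  have Hpos: "H x > 0" if "x \<in> {0..X}" for x using roll_wave_pos[OF F rw that] .
  have contH: "continuous_on {0..X} H" by (rule roll_wave_continuous_on[OF rw])
  have contD: "continuous_on {0..X} D"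
    unfolding D_def
  proof (intro continuous_intros contH ballI)
    fix x assume "x \<in> {0..X}"
    then have "(H x)\<^sup>2 + Hs * H x + Hs\<^sup>2 > 0" using Hpos[of x] Hs by (intro add_pos_pos mult_pos_pos) auto
    then show "(H x)\<^sup>2 + Hs * H x + Hs\<^sup>2 \<noteq> 0" by simp
  qed
  have dH: "(H has_real_derivative D x) (at x)" if "x \<in> {0<..<X}" for x
    using dH0[of x] that by (simp add: at_within_Icc_at)
  have k: "k > 0" "k\<^sup>2 * F\<^sup>2 = Hs ^ 3" using q0_pos q0_squared F Hs by (auto simp: k_def)
  define a where "a = (\<lambda>x. H x / F\<^sup>2 - k\<^sup>2 / (H x)\<^sup>2)"
  define a' where "a' = (\<lambda>x. (1 / F\<^sup>2 + 2 * k\<^sup>2 / (H x) ^ 3) * D x)"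
  define P where "P = (\<lambda>l x. a' x - 1 + 2 * Q F Hs H x * k / (H x) ^ 3 + 2 * l * k / H x)"
  define R where "R = (\<lambda>l x. - (2 * Q F Hs H x / (H x)\<^sup>2 + l + 2 * k * D x / (H x)\<^sup>2))"
  \<comment> \<open>The zero of the map from \<open>l\<close> to \<open>P l xs\<close>, which equals
    P 0 xs + 2 l k / Hs.\<close>
  define L where "L = - P 0 xs * Hs / (2 * k)"
  have Qc: "Q F Hs H = (\<lambda>x. c * H x - k)" by (simp add: fun_eq_iff Q_def c_def k_def)
  have cont: "continuous_on {0..X} a" "continuous_on {0..X} (P l)" "continuous_on {0..X} (R l)" for l
    unfolding a_def P_def R_def a'_def Qc using Hpos F
    by (intro continuous_intros contH contD; fastforce)+
  \<comment> \<open>Since k^2 F^2 = Hs^3, the numerator of \<open>a\<close> is H^3 - Hs^3: the flow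
    passes from one characteristic regime to the other exactly at the sonic point.\<close>
  have a_sign: "(H x - Hs > 0 \<longrightarrow> a x > 0) \<and> (H x - Hs < 0 \<longrightarrow> a x < 0)" if "x \<in> {0..X}" for x
  proof -
    have "a x = ((H x)^3 - Hs^3) / (F\<^sup>2 * (H x)\<^sup>2)"
      using Hpos[OF that] F unfolding a_def k(2)[symmetric] by (simp add: field_simps power2_eq_square power3_eq_cube)
    moreover have "F\<^sup>2 * (H x)\<^sup>2 > 0" using Hpos[OF that] F by simp
    moreover have "Hs < H x \<Longrightarrow> Hs^3 < (H x)^3" "H x < Hs \<Longrightarrow> (H x)^3 < Hs^3"
      using Hs Hpos[OF that] by (auto intro!: power_strict_mono)
    ultimately show ?thesis by (auto simp: divide_neg_pos)
  qed
  have a_pos: "a x > 0" if "xs < x" "x \<le> X" for x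
    using strict_mono_onD[OF mono, of xs x] a_sign[of x] that xs by auto
  have a_neg: "a x < 0" if "x < xs" "0 \<le> x" for x
    using strict_mono_onD[OF mono, of x xs] a_sign[of x] that xs by auto
  show ?thesis
  proof (rule that[of L])
    fix l x :: real and h q :: "real \<Rightarrow> complex"
    assume l: "l > L" and conth: "continuous_on {0..X} h" and contq: "continuous_on {0..X} q"
      and eqs: "eigenvalue_equations F Hs X H (of_real l) h q"
      and norm: "normalized_at F Hs xs (of_real l) h q" and x: "x \<in> {0..X}"
    define u where "u = (\<lambda>x. Im (h x))"
    define M where "M = (\<lambda>x. Im (mass_flux F Hs h q x))"
    define N where "N = (\<lambda>x. Im (momentum_flux F Hs H h q x))"
    define N' where "N' = (\<lambda>x. u x - 2 * Q F Hs H x / (H x)\<^sup>2 * (M x + c * u x)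
        + 2 * (Q F Hs H x)\<^sup>2 / (H x)^3 * u x - l * (M x + c * u x))"
    have Imq: "Im (q x) = M x + c * u x" for x
      by (simp add: M_def u_def mass_flux_def c_def)
    have Mq: "M x = Im (q x) - c * u x" for x by (simp add: Imq)
    have dM: "(M has_real_derivative - l * u x) (at x)" if "x \<in> {0<..<X}" for x
      using eqs that unfolding eigenvalue_equations_def has_vector_derivative_complex_iff M_def u_def
      by (auto simp: Im_complex_of_real)
    have dN: "(N has_real_derivative N' x) (at x)" if "x \<in> {0<..<X}" for x
    proof -
      have "(N has_real_derivative Im (h x - of_real (2 * Q F Hs H x / (H x)\<^sup>2) * q x
            + of_real (2 * (Q F Hs H x)\<^sup>2 / (H x)^3) * h x - of_real l * q x)) (at x)"
        using eqs that unfolding eigenvalue_equations_def has_vector_derivative_complex_iff N_def by blast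
      moreover have "Im (h x - of_real (2 * Q F Hs H x / (H x)\<^sup>2) * q x
            + of_real (2 * (Q F Hs H x)\<^sup>2 / (H x)^3) * h x - of_real l * q x) = N' x"
        unfolding minus_complex.sel plus_complex.sel Im_complex_of_real times_complex.sel Re_complex_of_real Imq
        by (simp add: N'_def u_def)
      ultimately show ?thesis by simp
    qed
    have N: "N x = (c - 2 * k / H x) * M x + a x * u x" if "x \<in> {0..X}" for x
    proof -
      have "N x = (2 * Q F Hs H x / H x - c) * (M x + c * u x) + (- (Q F Hs H x)\<^sup>2 / (H x)\<^sup>2 + H x / F\<^sup>2) * u x"
        unfolding N_def momentum_flux_def plus_complex.sel Im_complex_of_real times_complex.sel Re_complex_of_real Imq
        by (simp add: u_def c_def)
      also have "\<dots> = (c - 2 * k / H x) * M x + a x * u x"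
        using Hpos[OF that] unfolding a_def Qc by (intro momentum_flux_identity) simp
      finally show ?thesis .
    qed
    define u' where "u' = (\<lambda>x. (- P l x * u x + R l x * M x) / a x)"
    \<comment> \<open>The equations give derivatives of the two fluxes only. Away from the sonic
      point \<open>u\<close> is recovered as a quotient of differentiable functions with denominator
      \<open>a\<close>.\<close>
    have du: "(u has_real_derivative u' x) (at x)" if x: "x \<in> {0<..<X}" "x \<noteq> xs" for x
    proof -
      have a0: "a x \<noteq> 0" using a_pos[of x] a_neg[of x] x by (cases "x < xs") auto
      have H0: "H x \<noteq> 0" using Hpos[of x] x by auto
      have da: "(a has_real_derivative a' x) (at x)"
        unfolding a_def using H0 F
        by (auto intro!: derivative_eq_intros dH[OF x(1)] simp: a'_def field_simps power2_eq_square power3_eq_cube)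
      have "((\<lambda>x. (N x - (c - 2 * k / H x) * M x) / a x) has_real_derivative
          ((N' x - (2 * k * D x / (H x)\<^sup>2 * M x + (c - 2 * k / H x) * (- l * u x))) * a x
            - (N x - (c - 2 * k / H x) * M x) * a' x) / (a x * a x)) (at x)"
        using H0 by (intro DERIV_divide DERIV_diff dN[OF x(1)] da a0)
          (auto intro!: derivative_eq_intros dH[OF x(1)] dM[OF x(1)] simp: power2_eq_square field_simps)
      also have "N x - (c - 2 * k / H x) * M x = a x * u x" using N[of x] x by simp
      also have "((N' x - (2 * k * D x / (H x)\<^sup>2 * M x + (c - 2 * k / H x) * (- l * u x))) * a x
            - a x * u x * a' x) / (a x * a x)
          = (N' x - (2 * k * D x / (H x)\<^sup>2 * M x + (c - 2 * k / H x) * (- l * u x)) - a' x * u x) / a x"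
        using a0 by (simp add: field_simps)
      also have "N' x - (2 * k * D x / (H x)\<^sup>2 * M x + (c - 2 * k / H x) * (- l * u x)) - a' x * u x
          = - P l x * u x + R l x * M x"
        using H0 unfolding N'_def P_def R_def Qc by (intro linearized_momentum_identity)
      finally have "((\<lambda>x. (N x - (c - 2 * k / H x) * M x) / a x) has_real_derivative u' x) (at x)"
        unfolding u'_def .
      then show ?thesis
      proof (rule DERIV_cong_ev[THEN iffD1, rotated -1])
        have "\<forall>\<^sub>F y in nhds x. y \<in> {0<..<X} - {xs}"
          using x by (intro eventually_nhds_in_open) auto
        then show "\<forall>\<^sub>F y in nhds x. (N y - (c - 2 * k / H y) * M y) / a y = u y"
        proof eventually_elim
          case (elim y)
          then have "a y \<noteq> 0" using a_pos[of y] a_neg[of y] by (cases "y < xs") auto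
          then show ?case using N[of y] elim by auto
        qed
      qed auto
    qed
    have contu: "continuous_on {0..X} u" and contM: "continuous_on {0..X} M"
      unfolding u_def M_def mass_flux_def by (intro continuous_intros conth contq)+
    have u_xs: "u xs = 0" "M xs = 0"
      using norm by (simp_all add: normalized_at_def u_def Mq)
    have P_xs: "P l xs > 0"
    proof -
      have "P l xs = P 0 xs + l * (2 * k / Hs)" by (simp add: P_def xs)
      also have "\<dots> = (l - L) * (2 * k / Hs)" using k Hs by (simp add: L_def field_simps)
      finally show ?thesis using l k Hs by simp
    qed
    \<comment> \<open>Taking \<sigma> = 1 or -1 measures the distance \<open>s\<close> from the
      sonic point in either direction. Both \<open>a\<close> and the derivative of \<open>u\<close>
      pick up the factor \<sigma>, so the leading coefficient becomes positive on both sides while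
      \<open>P\<close> and \<open>R\<close> are unchanged.\<close>
    have side: "u (xs + \<sigma> * s) = 0 \<and> M (xs + \<sigma> * s) = 0"
      if \<sigma>: "\<sigma>\<^sup>2 = 1" and b: "\<And>s. s \<in> {0..<b} \<Longrightarrow> xs + \<sigma> * s \<in> {0<..<X}"
        and sgn: "\<And>s. s \<in> {0<..<b} \<Longrightarrow> \<sigma> * a (xs + \<sigma> * s) > 0" and s: "s \<in> {0..<b}" for \<sigma> b s :: real
    proof (rule singular_linear_system_zero[of b "\<lambda>s. u (xs + \<sigma> * s)" "\<lambda>s. \<sigma> * u' (xs + \<sigma> * s)"
          "\<lambda>s. M (xs + \<sigma> * s)" "- l * \<sigma>" "\<lambda>s. \<sigma> * a (xs + \<sigma> * s)" "\<lambda>s. P l (xs + \<sigma> * s)" "\<lambda>s. R l (xs + \<sigma> * s)"])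
      have sub: "(\<lambda>s. xs + \<sigma> * s) ` {0..<b} \<subseteq> {0..X}" using b by fastforce
      show "continuous_on {0..<b} (\<lambda>s. u (xs + \<sigma> * s))" "continuous_on {0..<b} (\<lambda>s. M (xs + \<sigma> * s))"
        "continuous_on {0..<b} (\<lambda>s. \<sigma> * a (xs + \<sigma> * s))"
        "continuous_on {0..<b} (\<lambda>s. P l (xs + \<sigma> * s))" "continuous_on {0..<b} (\<lambda>s. R l (xs + \<sigma> * s))"
        using sub by (auto intro!: continuous_on_mult_left continuous_on_compose2[OF contu]
            continuous_on_compose2[OF contM] continuous_on_compose2[OF cont(1)]
            continuous_on_compose2[OF cont(2)] continuous_on_compose2[OF cont(3)] continuous_intros)
      fix s assume s: "s \<in> {0<..<b}"
      have shift: "((\<lambda>s. xs + \<sigma> * s) has_real_derivative \<sigma>) (at s)"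
        by (auto intro!: derivative_eq_intros)
      have in_cell: "xs + \<sigma> * s \<in> {0<..<X}" "xs + \<sigma> * s \<noteq> xs"
        using b[of s] s \<sigma> by auto
      show "((\<lambda>s. u (xs + \<sigma> * s)) has_real_derivative \<sigma> * u' (xs + \<sigma> * s)) (at s)"
        using DERIV_chain2[OF du[OF in_cell] shift] by (simp add: mult.commute)
      show "((\<lambda>s. M (xs + \<sigma> * s)) has_real_derivative - l * \<sigma> * u (xs + \<sigma> * s)) (at s)"
        using DERIV_chain2[OF dM[OF in_cell(1)] shift] by (simp add: mult_ac)
      show "\<sigma> * a (xs + \<sigma> * s) > 0" by (rule sgn[OF s])
      then have "a (xs + \<sigma> * s) \<noteq> 0" by auto
      then have "a (xs + \<sigma> * s) * u' (xs + \<sigma> * s)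
          = - P l (xs + \<sigma> * s) * u (xs + \<sigma> * s) + R l (xs + \<sigma> * s) * M (xs + \<sigma> * s)"
        by (simp add: u'_def)
      moreover have "\<sigma> * A * (\<sigma> * B) = A * B" for A B :: real
        using \<sigma> by (simp add: power2_eq_square mult.left_commute mult.assoc[symmetric])
      ultimately show "\<sigma> * a (xs + \<sigma> * s) * (\<sigma> * u' (xs + \<sigma> * s))
          = - P l (xs + \<sigma> * s) * u (xs + \<sigma> * s) + R l (xs + \<sigma> * s) * M (xs + \<sigma> * s)"
        by (simp only:)
    qed (use u_xs P_xs s in auto)
    have zero: "u y = 0 \<and> M y = 0" if y: "y \<in> {0<..<X}" for y
    proof (cases "y < xs")
      case True
      then show ?thesis using side[of "-1" xs "xs - y"] y xs a_neg by auto
    next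
      case False
      then show ?thesis using side[of 1 "X - xs" "y - xs"] y xs a_pos by auto
    qed
    \<comment> \<open>The differential equations hold on the open cell only; its two ends follow by
      continuity.\<close>
    have closure: "x \<in> closure {0<..<X}" using x xs by simp
    have "u x = 0"
      by (rule continuous_constant_on_closure[OF _ _ closure]) (use contu xs zero in auto)
    moreover have "M x = 0"
      by (rule continuous_constant_on_closure[OF _ _ closure]) (use contM xs zero in auto)
    ultimately have "Im (h x) = 0" "Im (q x) = 0" by (auto simp: Imq u_def)
    then show "h x \<in> \<real> \<and> q x \<in> \<real>" by (simp add: complex_is_Real_iff)
  qed
qed

section \<open>The determinant and its symmetry\<close>

text \<open>Continuity on the closed cell turns the one-sided limits into end-point values. The
  Bloch factor then enters affinely.\<close>

lemma Evans_Lopatinsky_eq: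
  fixes h q :: "complex \<Rightarrow> real \<Rightarrow> complex"
  assumes F: "F > 2" and rw: "roll_wave F Hs Hm Hp X H"
    and hq: "continuous_on {0..X} (h l)" "continuous_on {0..X} (q l)"
  defines "D \<equiv> \<lambda>x. H x - (Q F Hs H x)\<^sup>2 / (H x)\<^sup>2"
  shows "Evans_Lopatinsky F Hs X H h q l \<xi> =
    l * of_real (H X - H 0) * (momentum_flux F Hs H (h l) (q l) X
      - exp (\<i> * of_real (\<xi> * X)) * momentum_flux F Hs H (h l) (q l) 0)
    - (l * of_real (Q F Hs H X - Q F Hs H 0) - of_real (D X - D 0))
      * (mass_flux F Hs (h l) (q l) X - exp (\<i> * of_real (\<xi> * X)) * mass_flux F Hs (h l) (q l) 0)"
proof -
  have X: "0 < X" using rw by (simp add: roll_wave_def)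
  have contH: "continuous_on {0..X} H" by (rule roll_wave_continuous_on[OF rw])
  have H0: "H x \<noteq> 0" if "x \<in> {0..X}" for x using roll_wave_pos[OF F rw that] by simp
  have limits: "Lim (at_left X) f = f X" "Lim (at_right 0) f = f 0"
    if "continuous_on {0..X} f" for f :: "real \<Rightarrow> complex"
    using continuous_on_Icc_at_leftD[OF that X] continuous_on_Icc_at_rightD[OF that X]
    by (auto intro!: tendsto_Lim)
  have contQ: "continuous_on {0..X} (Q F Hs H)"
    unfolding Q_def by (intro continuous_intros contH)
  have cont: "continuous_on {0..X} (\<lambda>x. l * of_real (H x))"
    "continuous_on {0..X} (mass_flux F Hs (h l) (q l))"
    "continuous_on {0..X} (momentum_flux F Hs H (h l) (q l))"
    "continuous_on {0..X} (\<lambda>x. l * of_real (Q F Hs H x) - of_real (H x - (Q F Hs H x)\<^sup>2 / (H x)\<^sup>2))"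
    unfolding mass_flux_def momentum_flux_def
    by (intro continuous_intros contH contQ hq; use H0 F in force)+
  show ?thesis
    unfolding Evans_Lopatinsky_def jump_def Bloch_jump_def det_2 vector_2
      limits[OF cont(1)] limits[OF cont(2)] limits[OF cont(3)] limits[OF cont(4)]
    by (simp add: D_def algebra_simps)
qed

lemma spectral_domain_properties:
  assumes "F > 2" "Hs > 0"
  shows "open (spectral_domain F Hs)" "connected (spectral_domain F Hs)"
    "z \<in> spectral_domain F Hs \<Longrightarrow> cnj z \<in> spectral_domain F Hs"
    "x \<ge> 0 \<Longrightarrow> of_real x \<in> spectral_domain F Hs"
proof -
  show "open (spectral_domain F Hs)" unfolding spectral_domain_def by (rule open_halfspace_Re_gt)
  show "connected (spectral_domain F Hs)"
    unfolding spectral_domain_def by (intro convex_connected convex_halfspace_Re_gt)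
  show "z \<in> spectral_domain F Hs \<Longrightarrow> cnj z \<in> spectral_domain F Hs" by (simp add: spectral_domain_def)
  have "- (F - 2) / (2 * sqrt Hs) < 0" using assms by (intro divide_neg_pos) auto
  then show "x \<ge> 0 \<Longrightarrow> of_real x \<in> spectral_domain F Hs" by (simp add: spectral_domain_def)
qed

lemma solution_family_cnj_symmetric:
  assumes F: "F > 2" and rw: "roll_wave F Hs Hm Hp X H" and xs: "0 < xs" "xs < X" "H xs = Hs"
    and fam: "analytic_solution_family F Hs X H xs h q" and x: "x \<in> {0..X}"
  shows "cnj_symmetric_on (\<lambda>l. h l x) (spectral_domain F Hs)"
    "cnj_symmetric_on (\<lambda>l. q l x) (spectral_domain F Hs)"
proof -
  have Hs: "Hs > 0" using rw by (simp add: roll_wave_def)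
  note S = spectral_domain_properties[OF F Hs]
  obtain L where L: "\<And>l h q x. l > L \<Longrightarrow> continuous_on {0..X} h \<Longrightarrow> continuous_on {0..X} q \<Longrightarrow>
     eigenvalue_equations F Hs X H (of_real l) h q \<Longrightarrow> normalized_at F Hs xs (of_real l) h q \<Longrightarrow>
     x \<in> {0..X} \<Longrightarrow> h x \<in> \<real> \<and> q x \<in> \<real>"
    by (rule eventually_real_eigenfunctions[OF F rw xs]) blast
  \<comment> \<open>The maximum with 0 keeps the real ray beyond \<open>b\<close> inside the
    spectral domain.\<close>
  define b where "b = max L 0"
  define U where "U = complex_of_real ` {b<..}"
  have U: "U \<subseteq> spectral_domain F Hs" "U \<subseteq> \<real>" using S(4) by (auto simp: U_def b_def)
  have a: "of_real (b + 1) \<in> spectral_domain F Hs" by (rule S(4)) (simp add: b_def)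
  have limpt: "of_real (b + 1) islimpt U"
    unfolding islimpt_approachable
  proof (intro allI impI)
    fix e :: real assume "e > 0"
    then show "\<exists>z\<in>U. z \<noteq> of_real (b + 1) \<and> dist z (of_real (b + 1)) < e"
      by (intro bexI[of _ "of_real (b + 1 + e / 2)"])
        (auto simp: U_def dist_norm simp del: of_real_add simp flip: of_real_diff)
  qed
  have real: "h l x \<in> \<real> \<and> q l x \<in> \<real>" if l: "l \<in> U" for l
  proof -
    obtain t where t: "l = of_real t" "t > b" using l by (auto simp: U_def)
    have "l \<in> spectral_domain F Hs" using l U by blast
    then have "h l real_analytic_on {0..X}" "q l real_analytic_on {0..X}"
      "eigenvalue_equations F Hs X H l (h l) (q l)" "normalized_at F Hs xs l (h l) (q l)"
      using fam unfolding analytic_solution_family_def by blast+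
    then show ?thesis
      using L[of t "h l" "q l" x] t x by (auto simp: b_def intro: real_analytic_on_imp_continuous_on)
  qed
  have holo: "(\<lambda>l. h l x) holomorphic_on spectral_domain F Hs" "(\<lambda>l. q l x) holomorphic_on spectral_domain F Hs"
    using fam x unfolding analytic_solution_family_def by blast+
  show "cnj_symmetric_on (\<lambda>l. h l x) (spectral_domain F Hs)"
    by (rule cnj_symmetric_on_continuation[OF holo(1) S(1-3) U(1) a limpt U(2)]) (use real in blast)+
  show "cnj_symmetric_on (\<lambda>l. q l x) (spectral_domain F Hs)"
    by (rule cnj_symmetric_on_continuation[OF holo(2) S(1-3) U(1) a limpt U(2)]) (use real in blast)+
qed

section \<open>The spectral curves and their coefficients\<close>

theorem corollary1p5:
  fixes F Hs Hm Hp X xs :: real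
    and H :: "real \<Rightarrow> real"
    and h q :: "complex \<Rightarrow> real \<Rightarrow> complex"
    and \<Delta> \<Delta>hat :: "complex \<Rightarrow> real \<Rightarrow> complex"
    and \<alpha>0 \<alpha>1 :: complex
  assumes "F > 2"
    and "roll_wave F Hs Hm Hp X H"
    and "0 < xs" and "xs < X" and "H xs = Hs"
    and "analytic_solution_family F Hs X H xs h q"
    and "\<Delta> = Evans_Lopatinsky F Hs X H h q"
    and "\<And>\<xi>. \<xi> \<in> {-pi/X..pi/X} \<Longrightarrow> (\<lambda>l. \<Delta>hat l \<xi>) holomorphic_on spectral_domain F Hs"
    and "\<And>l \<xi>. l \<in> spectral_domain F Hs \<Longrightarrow> \<xi> \<in> {-pi/X..pi/X} \<Longrightarrow> \<Delta> l \<xi> = l * \<Delta>hat l \<xi>"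
    and "\<alpha>0 = deriv (\<lambda>l. \<Delta>hat l 0) 0"
    and "\<alpha>1 = vector_derivative (\<lambda>\<xi>. \<Delta>hat 0 \<xi>) (at 0)"
    and "root_of_multiplicity (\<lambda>l. \<Delta> l 0) 0 2"
  shows "\<alpha>0 \<noteq> 0 \<and>
    (\<exists>(lam1 :: real \<Rightarrow> complex) (lam2 :: real \<Rightarrow> complex) (\<alpha> :: real) (\<gamma> :: real)
        (r :: real \<Rightarrow> complex) (\<delta> :: real).
       \<delta> > 0 \<and>
       lam1 real_analytic_on {-\<delta><..<\<delta>} \<and> lam2 real_analytic_on {-\<delta><..<\<delta>} \<and>
       (\<forall>\<^sub>F (l, \<xi>) in nhds (0, 0). \<Delta> l \<xi> = 0 \<longleftrightarrow> l = lam1 \<xi> \<or> l = lam2 \<xi>) \<and>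
       r \<in> O[at 0](\<lambda>\<xi>. of_real (\<xi>\<^sup>2)) \<and>
       (\<forall>\<xi>. \<bar>\<xi>\<bar> < \<delta> \<longrightarrow>
          lam1 \<xi> = - \<i> * of_real \<xi> * of_real \<alpha> * (1 - \<i> * of_real \<xi> * of_real \<gamma> + r \<xi>) \<and>
          lam2 \<xi> = 0) \<and>
       of_real \<alpha> = \<alpha>1 / (\<i> * \<alpha>0) \<and>
       of_real \<alpha> = - of_real X * \<Delta>hat 0 (pi / X) / (2 * \<alpha>0))"
proof -
  note F = assms(1) and rw = assms(2) and fam = assms(6)
  define S where "S = spectral_domain F Hs"
  have Hs: "Hs > 0" and X: "X > 0" using rw by (simp_all add: roll_wave_def)
  note S = spectral_domain_properties[OF F Hs, folded S_def]
  have S0: "0 \<in> S" using S(4)[of 0] by simp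
  have cell: "0 \<in> {0..X}" "X \<in> {0..X}" using X by auto
  have sym: "cnj_symmetric_on (\<lambda>l. h l x) S" "cnj_symmetric_on (\<lambda>l. q l x) S" if "x \<in> {0..X}" for x
    unfolding S_def using solution_family_cnj_symmetric[OF F rw assms(3-5) fam that] by blast+
  have holo: "(\<lambda>l. h l x) holomorphic_on S" "(\<lambda>l. q l x) holomorphic_on S" if "x \<in> {0..X}" for x
    using fam that unfolding analytic_solution_family_def S_def by blast+
  have cont: "continuous_on {0..X} (h l)" "continuous_on {0..X} (q l)" if "l \<in> S" for l
    using fam that unfolding analytic_solution_family_def S_def
    by (blast intro: real_analytic_on_imp_continuous_on)+
  define D where "D = (\<lambda>x. H x - (Q F Hs H x)\<^sup>2 / (H x)\<^sup>2)"
  \<comment> \<open>The first column of the determinant does not involve \<xi>, so expanding it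
    gives one contribution from each end \<open>x\<close> of the cell.\<close>
  define W where "W = (\<lambda>x l. l * of_real (H X - H 0) * momentum_flux F Hs H (h l) (q l) x
    - (l * of_real (Q F Hs H X - Q F Hs H 0) - of_real (D X - D 0)) * mass_flux F Hs (h l) (q l) x)"
  have W_holo: "W x holomorphic_on S" if "x \<in> {0..X}" for x
    unfolding W_def momentum_flux_def mass_flux_def by (intro holomorphic_intros holo that)
  have W_sym: "cnj_symmetric_on (W x) S" if "x \<in> {0..X}" for x
    using sym[OF that] unfolding cnj_symmetric_on_def W_def momentum_flux_def mass_flux_def by simp
  have \<Delta>_W: "\<Delta> l \<xi> = W X l - exp (\<i> * of_real (\<xi> * X)) * W 0 l" if "l \<in> S" for l \<xi>
    unfolding assms(7) Evans_Lopatinsky_eq[where h=h and q=q and l=l, OF F rw cont[OF that]] W_def D_def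
    by (simp add: algebra_simps)
  have Bloch: "0 \<in> {- pi / X..pi / X}" "pi / X \<in> {- pi / X..pi / X}" using X by (auto simp: field_simps)
  have antiperiodic: "exp (\<i> * of_real (pi / X * X)) = -1" using X by (simp add: exp_pi_i')
  have "\<Delta> 0 0 = 0" "\<Delta> 0 (pi / X) = 0"
    using assms(9)[of 0 0] assms(9)[of 0 "pi / X"] Bloch S0 by (auto simp: S_def)
  then have "W X 0 - W 0 0 = 0" "W X 0 + W 0 0 = 0"
    unfolding \<Delta>_W[OF S0] antiperiodic by simp_all
  then have W0: "W X 0 = 0" "W 0 0 = 0" by (auto simp: add_eq_0_iff)
  obtain P where P: "P holomorphic_on S" "cnj_symmetric_on P S" "\<forall>z\<in>S. W X z = W X 0 + z * P z" "P 0 = deriv (W X) 0"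
    by (rule cnj_symmetric_on_first_order[OF W_holo[OF cell(2)] S(1) S0 W_sym[OF cell(2)]]) (rule that)
  obtain R where R: "R holomorphic_on S" "cnj_symmetric_on R S" "\<forall>z\<in>S. W 0 z = W 0 0 + z * R z" "R 0 = deriv (W 0) 0"
    by (rule cnj_symmetric_on_first_order[OF W_holo[OF cell(1)] S(1) S0 W_sym[OF cell(1)]]) (rule that)
  have \<Delta>_PR: "\<Delta> l \<xi> = l * (P l - exp (\<i> * of_real (\<xi> * X)) * R l)" if "l \<in> S" for l \<xi>
    unfolding \<Delta>_W[OF that] using bspec[OF P(3) that] bspec[OF R(3) that] W0 by (simp add: right_diff_distrib)
  \<comment> \<open>The factorization determines the reduced determinant only for nonzero
    \<open>l\<close>; its value at 0, needed for \<alpha>1 and at pi/X, comes from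
    holomorphy.\<close>
  have hat: "\<Delta>hat l \<xi> = P l - exp (\<i> * of_real (\<xi> * X)) * R l" if "l \<in> S" "\<xi> \<in> {- pi / X..pi / X}" for l \<xi>
  proof (rule holomorphic_cancel_ident[OF _ _ S(1) S0 _ that(1)])
    show "(\<lambda>l. \<Delta>hat l \<xi>) holomorphic_on S" using assms(8)[OF that(2)] by (simp add: S_def)
    show "(\<lambda>l. P l - exp (\<i> * of_real (\<xi> * X)) * R l) holomorphic_on S"
      by (intro holomorphic_intros P R)
    show "z * \<Delta>hat z \<xi> = z * (P z - exp (\<i> * of_real (\<xi> * X)) * R z)" if "z \<in> S" for z
      using assms(9)[of z \<xi>] \<Delta>_PR[OF that, of \<xi>] that \<open>\<xi> \<in> _\<close> unfolding S_def by metis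
  qed
  \<comment> \<open>At \<xi> = 0 the exponential is 1, so the double root concerns l (P - R): it
    yields both P(0) = R(0) and P'(0) \<noteq> R'(0).\<close>
  have "(\<lambda>l. P l - R l) 0 = 0 \<and> deriv (\<lambda>l. P l - R l) 0 \<noteq> 0"
    by (rule double_root_ident_factor[OF _ S(1,2) S0 _ assms(12)])
      (use \<Delta>_PR[of _ 0] P R in \<open>auto intro: holomorphic_on_diff\<close>)
  moreover have dPR: "((\<lambda>l. P l - R l) has_field_derivative deriv P 0 - deriv R 0) (at 0)"
    by (intro DERIV_diff holomorphic_derivI[OF _ S(1) S0] P R)
  ultimately have PR0: "P 0 = R 0" and ne: "deriv P 0 \<noteq> deriv R 0" by (auto simp: DERIV_imp_deriv)
  have "((\<lambda>l. \<Delta>hat l 0) has_field_derivative deriv P 0 - deriv R 0) (at 0)"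
    by (rule has_field_derivative_transform_within_open[OF dPR S(1) S0]) (use hat Bloch in simp)
  then have \<alpha>0: "\<alpha>0 = deriv P 0 - deriv R 0" by (simp add: assms(10) DERIV_imp_deriv)
  have "((\<lambda>\<xi>. P 0 - exp (\<i> * of_real (\<xi> * X)) * R 0) has_vector_derivative - (\<i> * of_real X * R 0)) (at 0)"
  proof -
    have "((\<lambda>z. P 0 - exp (\<i> * (z * of_real X)) * R 0) has_field_derivative - (\<i> * of_real X * R 0)) (at (of_real 0))"
      by (auto intro!: derivative_eq_intros)
    from has_vector_derivative_real_field[OF this] show ?thesis by simp
  qed
  then have "((\<lambda>\<xi>. \<Delta>hat 0 \<xi>) has_vector_derivative - (\<i> * of_real X * R 0)) (at 0)"
    \<comment> \<open>The formula for \<open>\<Delta>hat\<close> is available on the Bloch interval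
      only, and 0 is an interior point of it.\<close>
    by (rule has_vector_derivative_transform_within_open[of _ _ _ "{- pi / X<..<pi / X}"])
      (use hat[OF S0] X in auto)
  then have \<alpha>1: "\<alpha>1 = - (\<i> * of_real X * R 0)" by (simp add: assms(11) vector_derivative_at)
  \<comment> \<open>At pi/X the exponential is -1, so the value is P(0) + R(0), with P(0) =
    R(0).\<close>
  have hat_pi: "\<Delta>hat 0 (pi / X) = 2 * R 0"
    unfolding hat[OF S0 Bloch(2)] antiperiodic using PR0 by simp
  have \<alpha>0_ne: "\<alpha>0 \<noteq> 0" using ne by (simp add: \<alpha>0)
  then have \<alpha>_eqs: "\<alpha>1 / (\<i> * \<alpha>0) = - of_real X * R 0 / \<alpha>0"
    "- of_real X * \<Delta>hat 0 (pi / X) / (2 * \<alpha>0) = - of_real X * R 0 / \<alpha>0"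
    by (simp_all add: \<alpha>1 hat_pi field_simps)
  show ?thesis
    unfolding \<alpha>_eqs using two_root_curves[OF P(1) R(1) S(1) S0 P(2) R(2) PR0 ne _ \<Delta>_PR, folded \<alpha>0] X \<alpha>0_ne
    by (simp only: conj_absorb simp_thms)
qed

end
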